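(* Let $\mathrm{ZFI}^\ast$ be the theory $\mathrm{ZF}+\mathrm{Coll}(I)+\mathrm{Cof}(I)+\mathrm{Indis}(I)$ and $\mathrm{ZFI}^\ast_<$ the theory $\mathrm{ZF}(<)+\mathrm{GW}+\mathrm{Coll}(<,I)+\mathrm{Cof}(I)+\mathrm{Indis}_<(I)$. Then: (a) $\mathrm{ZFI}^\ast$ proves, for every $n\in\omega$ and every $\mathcal{L}_{\mathrm{Set}}$-formula $\varphi(x_1,\dots,x_n,y)$, the apartness sentence $\forall i\in I\ \forall j\in I\,[i<j\to\forall\bar x\in(\mathrm{V}(i))^n\,(\exists y\,\varphi(\bar x,y)\to\exists y\in\mathrm{V}(j)\,\varphi(\bar x,y))]$; (b) $\mathrm{ZFI}^\ast$ proves, for all $n,r\in\omega$ with $r\ge1$ and every $\mathcal{L}_{\mathrm{Set}}$-formula $\varphi$ with free variables among $\bar x=(x_1,\dots,x_n)$ and $n+1+r$ total arguments, the diagonal indiscernibility sentence $\forall i\in I\ \forall\bar j\in[I]^r\ \forall\bar k\in[I]^r\,[(i<j_1\wedge i<k_1)\to\forall\bar x\in(\mathrm{V}(i))^n\,(\varphi(\bar x,i,j_1,\dots,j_r)\leftrightarrow\varphi(\bar x,i,k_1,\dots,k_r))]$; (c) $\mathrm{ZFI}^\ast_<$ proves the apartness sentences of (a) for all $\mathcal{L}_{\mathrm{Set}}(<)$-formulae $\varphi$; (d) $\mathrm{ZFI}^\ast_<$ proves the diagonal indiscernibility sentences of (b) for all $\mathcal{L}_{\mathrm{Set}}(<)$-formulae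 $\varphi$.
   Context: $\mathcal{L}_{\mathrm{Set}}=\{=,\in\}$, $I$ a unary predicate, $<$ a binary relation symbol. $\mathrm{ZF}(<)$ is ZF with separation and collection for $\mathcal{L}_{\mathrm{Set}}\cup\{<\}$-formulae. $\mathrm{Coll}(I)$ is the collection scheme $(\forall x\in v\,\exists y\,\psi)\to\exists w\,\forall x\in v\,\exists y\in w\,\psi$ for $\mathcal{L}_{\mathrm{Set}}\cup\{I\}$-formulae $\psi$ (with parameters); $\mathrm{Coll}(<,I)$ is the same for $\mathcal{L}_{\mathrm{Set}}\cup\{<,I\}$-formulae. $\mathrm{GW}$: "$<$ is a linear order and every nonempty set has a $<$-least element". $\mathrm{Cof}(I)$: "$I$ is a cofinal subclass of $\mathrm{Ord}$". $\mathrm{Indis}(I)$ (resp. $\mathrm{Indis}_<(I)$): for each $\mathcal{L}_{\mathrm{Set}}$- (resp. $\mathcal{L}_{\mathrm{Set}}(<)$-) formula $\varphi(v_1,\dots,v_n)$, for all $x_1\in\cdots\in x_n$ and $y_1\in\cdots\in y_n$ from $I$, $\varphi(\bar x)\leftrightarrow\varphi(\bar y)$. For ordinals $i<j$ means $i\in j$; $[I]^r$ is the class of increasing $r$-tuples from $I$; $\mathrm{V}(i)$ is the $i$-th level of the von Neumann hierarchy. *)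

theory Defs
  imports Main
begin

section \<open>First-order formulae\<close>

text \<open>
  Formulae over equality, membership, a binary symbol \<open><\<close> and a unary symbol \<open>I\<close>, with de Bruijn
  indices as variables: below \<open>All\<close>, index 0 is the bound variable and the outer indices are
  shifted by one.
\<close>

datatype fm =
    Eq nat nat  (infix "\<^bold>=" 58)
  | Mem nat nat  (infix "\<^bold>\<in>" 58)
  | Less nat nat  (infix "\<^bold><" 58)
  | InI nat
  | Bot
  | Imp fm fm  (infixr "\<^bold>\<longrightarrow>" 54)
  | All fm

definition Neg :: "fm \<Rightarrow> fm" where
  "Neg p = (p \<^bold>\<longrightarrow> Bot)"

definition Top :: fm where
  "Top = Neg Bot"

definition Or :: "fm \<Rightarrow> fm \<Rightarrow> fm"  (infixr "\<^bold>\<or>" 55) where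
  "(p \<^bold>\<or> q) = (Neg p \<^bold>\<longrightarrow> q)"

definition And :: "fm \<Rightarrow> fm \<Rightarrow> fm"  (infixr "\<^bold>\<and>" 56) where
  "(p \<^bold>\<and> q) = Neg (p \<^bold>\<longrightarrow> Neg q)"

definition Iff :: "fm \<Rightarrow> fm \<Rightarrow> fm"  (infix "\<^bold>\<longleftrightarrow>" 53) where
  "(p \<^bold>\<longleftrightarrow> q) = ((p \<^bold>\<longrightarrow> q) \<^bold>\<and> (q \<^bold>\<longrightarrow> p))"

definition Ex :: "fm \<Rightarrow> fm" where
  "Ex p = Neg (All (Neg p))"

definition BAll :: "nat \<Rightarrow> fm \<Rightarrow> fm" where
  "BAll v p = All (0 \<^bold>\<in> Suc v \<^bold>\<longrightarrow> p)"

definition BEx :: "nat \<Rightarrow> fm \<Rightarrow> fm" where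
  "BEx v p = Ex (0 \<^bold>\<in> Suc v \<^bold>\<and> p)"

definition Alls :: "nat \<Rightarrow> fm \<Rightarrow> fm" where
  "Alls n = All ^^ n"

definition Conj :: "fm list \<Rightarrow> fm" where
  "Conj ps = foldr And ps Top"

primrec fv :: "fm \<Rightarrow> nat set" where
  "fv (a \<^bold>= b) = {a, b}"
| "fv (a \<^bold>\<in> b) = {a, b}"
| "fv (a \<^bold>< b) = {a, b}"
| "fv (InI a) = {a}"
| "fv Bot = {}"
| "fv (p \<^bold>\<longrightarrow> q) = fv p \<union> fv q"
| "fv (All p) = {v. Suc v \<in> fv p}"

datatype sym = LessSym | ISym

primrec syms :: "fm \<Rightarrow> sym set" where
  "syms (a \<^bold>= b) = {}"
| "syms (a \<^bold>\<in> b) = {}"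
| "syms (a \<^bold>< b) = {LessSym}"
| "syms (InI a) = {ISym}"
| "syms Bot = {}"
| "syms (p \<^bold>\<longrightarrow> q) = syms p \<union> syms q"
| "syms (All p) = syms p"

text \<open>
  \<open>formulas L k\<close>: the formulae with arguments \<open>0, \<dots>, k - 1\<close> in the language of set theory extended
  by the symbols in \<open>L\<close>; thus \<open>L = {}\<close> is the language of set theory itself.
\<close>

definition formulas :: "sym set \<Rightarrow> nat \<Rightarrow> fm set" where
  "formulas L k = {p. syms p \<subseteq> L \<and> fv p \<subseteq> {..<k}}"

text \<open>
  Simultaneous capture-avoiding substitution of variables for variables. There are no function
  symbols, so this covers all substitution of terms.
\<close>

primrec rename :: "(nat \<Rightarrow> nat) \<Rightarrow> fm \<Rightarrow> fm" where
  "rename f (a \<^bold>= b) = (f a \<^bold>= f b)"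
| "rename f (a \<^bold>\<in> b) = (f a \<^bold>\<in> f b)"
| "rename f (a \<^bold>< b) = (f a \<^bold>< f b)"
| "rename f (InI a) = InI (f a)"
| "rename f Bot = Bot"
| "rename f (p \<^bold>\<longrightarrow> q) = (rename f p \<^bold>\<longrightarrow> rename f q)"
| "rename f (All p) = All (rename (\<lambda>v. case v of 0 \<Rightarrow> 0 | Suc m \<Rightarrow> Suc (f m)) p)"

text \<open>Instantiation of the variable 0 of the body of a quantifier.\<close>

definition inst :: "fm \<Rightarrow> nat \<Rightarrow> fm" where
  "inst p t = rename (\<lambda>v. case v of 0 \<Rightarrow> t | Suc m \<Rightarrow> m) p"

text \<open>The formula \<open>p(v\<^sub>0, \<dots>, v\<^sub>k\<^sub>-\<^sub>1)\<close> for \<open>p \<in> formulas L k\<close> and a list of \<open>k\<close> variables.\<close>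

definition app :: "fm \<Rightarrow> nat list \<Rightarrow> fm" where
  "app p vs = rename (\<lambda>m. vs ! m) p"

section \<open>Provability\<close>

text \<open>
  Classical natural deduction with equality. The assumptions discharged in a derivation must be in
  the language \<open>L\<close>; so if the hypotheses are in \<open>L\<close>, all formulae of the derivation are.
\<close>

inductive derives :: "sym set \<Rightarrow> fm set \<Rightarrow> fm \<Rightarrow> bool" for L :: "sym set" where
  Assm: "p \<in> \<Gamma> \<Longrightarrow> derives L \<Gamma> p"
| ImpI: "syms p \<subseteq> L \<Longrightarrow> derives L (insert p \<Gamma>) q \<Longrightarrow> derives L \<Gamma> (p \<^bold>\<longrightarrow> q)"
| ImpE: "derives L \<Gamma> (p \<^bold>\<longrightarrow> q) \<Longrightarrow> derives L \<Gamma> p \<Longrightarrow> derives L \<Gamma> q"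
| Contr: "syms p \<subseteq> L \<Longrightarrow> derives L (insert (Neg p) \<Gamma>) Bot \<Longrightarrow> derives L \<Gamma> p"
| AllI: "derives L (rename Suc ` \<Gamma>) p \<Longrightarrow> derives L \<Gamma> (All p)"
| AllE: "derives L \<Gamma> (All p) \<Longrightarrow> derives L \<Gamma> (inst p t)"
| EqRefl: "derives L \<Gamma> (a \<^bold>= a)"
| EqSubst: "derives L \<Gamma> (a \<^bold>= b) \<Longrightarrow> derives L \<Gamma> (inst p a) \<Longrightarrow> derives L \<Gamma> (inst p b)"

section \<open>Set-theoretic notions\<close>

definition Sub :: "nat \<Rightarrow> nat \<Rightarrow> fm" where
  "Sub a b = BAll a (0 \<^bold>\<in> Suc b)"

definition Nonempty :: "nat \<Rightarrow> fm" where
  "Nonempty a = Ex (0 \<^bold>\<in> Suc a)"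

text \<open>\<open>s = x \<union> {x}\<close>\<close>
definition IsSucc :: "nat \<Rightarrow> nat \<Rightarrow> fm" where
  "IsSucc s x = All (0 \<^bold>\<in> Suc s \<^bold>\<longleftrightarrow> (0 \<^bold>\<in> Suc x \<^bold>\<or> 0 \<^bold>= Suc x))"

text \<open>\<open>p = {a, b}\<close>\<close>
definition IsUPair :: "nat \<Rightarrow> nat \<Rightarrow> nat \<Rightarrow> fm" where
  "IsUPair p a b = All (0 \<^bold>\<in> Suc p \<^bold>\<longleftrightarrow> (0 \<^bold>= Suc a \<^bold>\<or> 0 \<^bold>= Suc b))"

text \<open>\<open>p = {{a}, {a, b}}\<close>\<close>
definition IsOPair :: "nat \<Rightarrow> nat \<Rightarrow> nat \<Rightarrow> fm" where
  "IsOPair p a b = Ex (Ex (IsUPair 1 (a + 2) (a + 2) \<^bold>\<and> IsUPair 0 (a + 2) (b + 2) \<^bold>\<and> IsUPair (p + 2) 1 0))"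

text \<open>\<open>(a, b) \<in> f\<close>\<close>
definition Maps :: "nat \<Rightarrow> nat \<Rightarrow> nat \<Rightarrow> fm" where
  "Maps f a b = BEx f (IsOPair 0 (Suc a) (Suc b))"

text \<open>\<open>x\<close> is transitive and strictly well-ordered by membership.\<close>
definition Ord :: "nat \<Rightarrow> fm" where
  "Ord x = Conj
    [BAll x (Sub 0 (x + 1)),
     BAll x (Neg (0 \<^bold>\<in> 0)),
     BAll x (BAll (x + 1) (BAll (x + 2) (2 \<^bold>\<in> 1 \<^bold>\<and> 1 \<^bold>\<in> 0 \<^bold>\<longrightarrow> 2 \<^bold>\<in> 0))),
     BAll x (BAll (x + 1) (1 \<^bold>\<in> 0 \<^bold>\<or> 1 \<^bold>= 0 \<^bold>\<or> 0 \<^bold>\<in> 1)),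
     All (Sub 0 (x + 1) \<^bold>\<and> Nonempty 0 \<^bold>\<longrightarrow> BEx 0 (BAll 1 (1 \<^bold>\<in> 0 \<^bold>\<or> 1 \<^bold>= 0)))]"

text \<open>
  \<open>v = V(a)\<close>: there is a function \<open>f\<close> with domain \<open>a \<union> {a}\<close> such that
  \<open>f(\<beta>)\<close> is the union of the power sets of the \<open>f(\<gamma>)\<close>, \<open>\<gamma> \<in> \<beta>\<close>, for all \<open>\<beta>\<close> in the domain,
  and \<open>f(a) = v\<close>.
\<close>
definition IsV :: "nat \<Rightarrow> nat \<Rightarrow> fm" where
  "IsV a v = Ex (Conj
    [BAll 0 (Ex (Ex (IsOPair 2 1 0 \<^bold>\<and> (1 \<^bold>\<in> a + 4 \<^bold>\<or> 1 \<^bold>= a + 4)))),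
     All (0 \<^bold>\<in> a + 2 \<^bold>\<or> 0 \<^bold>= a + 2 \<^bold>\<longrightarrow> Ex (All (Maps 3 2 0 \<^bold>\<longleftrightarrow> 0 \<^bold>= 1))),
     All (All ((1 \<^bold>\<in> a + 3 \<^bold>\<or> 1 \<^bold>= a + 3) \<^bold>\<and> Maps 2 1 0 \<^bold>\<longrightarrow>
       All (0 \<^bold>\<in> 1 \<^bold>\<longleftrightarrow> Ex (Ex (1 \<^bold>\<in> 4 \<^bold>\<and> Maps 5 1 0 \<^bold>\<and> Sub 2 0))))),
     Maps 0 (a + 1) (v + 1)])"

text \<open>\<open>x \<in> V(a)\<close>\<close>
definition InV :: "nat \<Rightarrow> nat \<Rightarrow> fm" where
  "InV x a = Ex (IsV (a + 1) 0 \<^bold>\<and> x + 1 \<^bold>\<in> 0)"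

text \<open>The listed variables form an increasing tuple from \<open>I\<close>.\<close>
fun IncrI :: "nat list \<Rightarrow> fm" where
  "IncrI [] = Top"
| "IncrI [u] = InI u"
| "IncrI (u # v # vs) = (InI u \<^bold>\<and> u \<^bold>\<in> v \<^bold>\<and> IncrI (v # vs))"

section \<open>The theories\<close>

definition Extensionality :: fm where
  "Extensionality = All (All (All (0 \<^bold>\<in> 2 \<^bold>\<longleftrightarrow> 0 \<^bold>\<in> 1) \<^bold>\<longrightarrow> 1 \<^bold>= 0))"

definition Foundation :: fm where
  "Foundation = All (Nonempty 0 \<^bold>\<longrightarrow> BEx 0 (BAll 1 (Neg (0 \<^bold>\<in> 1))))"

definition Pairing :: fm where
  "Pairing = All (All (Ex (IsUPair 0 2 1)))"

definition Union :: fm where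
  "Union = All (Ex (All (0 \<^bold>\<in> 1 \<^bold>\<longleftrightarrow> BEx 2 (1 \<^bold>\<in> 0))))"

definition Powerset :: fm where
  "Powerset = All (Ex (All (0 \<^bold>\<in> 1 \<^bold>\<longleftrightarrow> Sub 0 2)))"

definition Infinity :: fm where
  "Infinity = Ex (BEx 0 (Neg (Nonempty 0)) \<^bold>\<and> BAll 0 (BEx 1 (IsSucc 0 1)))"

text \<open>
  \<open>\<forall>z\<^sub>1 \<dots> z\<^sub>n \<forall>v \<exists>w \<forall>x (x \<in> w \<longleftrightarrow> x \<in> v \<and> p(x, z\<^sub>1, \<dots>, z\<^sub>n))\<close>
\<close>
definition separation :: "nat \<Rightarrow> fm \<Rightarrow> fm" where
  "separation n p = Alls n (All (Ex (All (0 \<^bold>\<in> 1 \<^bold>\<longleftrightarrow> (0 \<^bold>\<in> 2 \<^bold>\<and> app p (0 # [3..<n + 3]))))))"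

text \<open>
  \<open>\<forall>z\<^sub>1 \<dots> z\<^sub>n \<forall>v ((\<forall>x \<in> v. \<exists>y. p(x, y, z\<^sub>1, \<dots>, z\<^sub>n)) \<longrightarrow> \<exists>w. \<forall>x \<in> v. \<exists>y \<in> w. p(x, y, z\<^sub>1, \<dots>, z\<^sub>n))\<close>
\<close>
definition collection :: "nat \<Rightarrow> fm \<Rightarrow> fm" where
  "collection n p = Alls n (All
    (BAll 0 (Ex (app p ([1, 0] @ [3..<n + 3]))) \<^bold>\<longrightarrow>
     Ex (BAll 1 (BEx 1 (app p ([1, 0] @ [4..<n + 4]))))))"

definition Sep :: "sym set \<Rightarrow> fm set" where
  "Sep L = {separation n p | n p. p \<in> formulas L (n + 1)}"

definition Coll :: "sym set \<Rightarrow> fm set" where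
  "Coll L = {collection n p | n p. p \<in> formulas L (n + 2)}"

definition ZF :: "sym set \<Rightarrow> fm set" where
  "ZF L = {Extensionality, Foundation, Pairing, Union, Powerset, Infinity} \<union> Sep L \<union> Coll L"

definition GW :: fm where
  "GW = Conj
    [All (Neg (0 \<^bold>< 0)),
     All (All (All (2 \<^bold>< 1 \<^bold>\<and> 1 \<^bold>< 0 \<^bold>\<longrightarrow> 2 \<^bold>< 0))),
     All (All (1 \<^bold>< 0 \<^bold>\<or> 1 \<^bold>= 0 \<^bold>\<or> 0 \<^bold>< 1)),
     All (Nonempty 0 \<^bold>\<longrightarrow> BEx 0 (BAll 1 (1 \<^bold>< 0 \<^bold>\<or> 1 \<^bold>= 0)))]"

definition Cof :: fm where
  "Cof = (All (InI 0 \<^bold>\<longrightarrow> Ord 0) \<^bold>\<and> All (Ord 0 \<^bold>\<longrightarrow> Ex (InI 0 \<^bold>\<and> (1 \<^bold>\<in> 0 \<^bold>\<or> 1 \<^bold>= 0))))"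

definition indiscernibility :: "nat \<Rightarrow> fm \<Rightarrow> fm" where
  "indiscernibility n p = (let xs = [n..<2 * n]; ys = [0..<n] in
    Alls n (Alls n (IncrI xs \<^bold>\<and> IncrI ys \<^bold>\<longrightarrow> (app p xs \<^bold>\<longleftrightarrow> app p ys))))"

definition Indis :: "sym set \<Rightarrow> fm set" where
  "Indis L = {indiscernibility n p | n p. p \<in> formulas L n}"

definition ZFI :: "fm set" where
  "ZFI = ZF {} \<union> Coll {ISym} \<union> {Cof} \<union> Indis {}"

definition ZFI_less :: "fm set" where
  "ZFI_less = ZF {LessSym} \<union> {GW} \<union> Coll {LessSym, ISym} \<union> {Cof} \<union> Indis {LessSym}"

section \<open>Apartness and diagonal indiscernibility\<close>

text \<open>
  Arguments of \<open>p\<close>: \<open>x\<^sub>1, \<dots>, x\<^sub>n, y\<close>. Below the quantifiers \<open>\<forall>i \<forall>j\<close> and \<open>\<forall>x\<^sub>n \<dots> \<forall>x\<^sub>1\<close>, the variables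
  \<open>x\<^sub>1, \<dots>, x\<^sub>n, j, i\<close> are \<open>0, \<dots>, n - 1, n, n + 1\<close>. The order of the ordinals \<open>i, j\<close> is membership,
  not the symbol \<open><\<close>.
\<close>
definition apartness :: "nat \<Rightarrow> fm \<Rightarrow> fm" where
  "apartness n p = All (All (InI 1 \<^bold>\<and> InI 0 \<^bold>\<and> 1 \<^bold>\<in> 0 \<^bold>\<longrightarrow>
    Alls n (Conj (map (\<lambda>x. InV x (n + 1)) [0..<n]) \<^bold>\<longrightarrow>
      Ex (app p ([1..<n + 1] @ [0])) \<^bold>\<longrightarrow>
      Ex (InV 0 (n + 1) \<^bold>\<and> app p ([1..<n + 1] @ [0])))))"

text \<open>
  Arguments of \<open>p\<close>: \<open>x\<^sub>1, \<dots>, x\<^sub>n, i, j\<^sub>1, \<dots>, j\<^sub>r\<close>. Below the quantifiers over \<open>i\<close>, the \<open>j\<close>'s and the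
  \<open>k\<close>'s, the variables are \<open>i = 2r\<close>, \<open>j\<^sub>m\<^sub>+\<^sub>1 = r + m\<close>, \<open>k\<^sub>m\<^sub>+\<^sub>1 = m\<close>; the quantifiers over the \<open>x\<close>'s
  shift them by \<open>n\<close>.
\<close>
definition diagonal_indis :: "nat \<Rightarrow> nat \<Rightarrow> fm \<Rightarrow> fm" where
  "diagonal_indis n r p = All (Alls r (Alls r
    (InI (2 * r) \<^bold>\<and> IncrI [r..<2 * r] \<^bold>\<and> IncrI [0..<r] \<^bold>\<and> 2 * r \<^bold>\<in> r \<^bold>\<and> 2 * r \<^bold>\<in> 0 \<^bold>\<longrightarrow>
      Alls n (Conj (map (\<lambda>x. InV x (2 * r + n)) [0..<n]) \<^bold>\<longrightarrow>
        (app p ([0..<n] @ [2 * r + n] @ [r + n..<2 * r + n]) \<^bold>\<longleftrightarrow>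
         app p ([0..<n] @ [2 * r + n] @ [n..<r + n]))))))"

end

theory Submission
  imports Defs "HOL-Library.Countable_Set"
begin

text \<open>
  By the completeness theorem it suffices to argue in a model \<open>M\<close> of the theory.

  Apartness: given \<open>i \<in> I\<close>, collection bounds witnesses for all tuples from \<open>V(i)\<close> by some \<open>V(\<beta>)\<close>, and
  cofinality of \<open>I\<close> gives one \<open>j \<in> I\<close> above \<open>i\<close> and \<open>\<beta>\<close>. So apartness holds for this pair \<open>i, j\<close>, and
  by indiscernibility for all pairs.

  Diagonal indiscernibility: it suffices to compare \<open>j\<^sub>1 < \<dots> < j\<^sub>r\<close> with a tuple \<open>l\<^sub>1 < \<dots> < l\<^sub>r\<close> above it,
  and by indiscernibility \<open>i, j, l\<close> either agree on \<open>V(i)\<close> for all such \<open>i, j, l\<close> or for none. In the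
  latter case tuples \<open>j < l\<close> define distinct subsets of \<open>V(i)\<^sup>n\<close>. But collection for formulae
  with \<open>I\<close>, applied to the power set of (a set of codes for) \<open>V(i)\<^sup>n\<close>, yields a bound \<open>\<beta>\<close> such that each
  subset defined by some tuple is defined by one below \<open>\<beta>\<close>; a tuple \<open>l\<close> above \<open>\<beta>\<close> gives a contradiction.
\<close>

section \<open>Renaming\<close>

text \<open>Separation is available only for formulae over a symbol set \<open>K\<close>, which is
  \<open>{}\<close> or \<open>{LessSym}\<close> in the two theories, whereas collection may also
  mention \<open>I\<close>. No set can thus be cut out by a condition on \<open>I\<close>, and
  replacement, ordinal induction and recursion are confined to \<open>K\<close>. In particular, the
  subsets of the code set that are defined by tuples from \<open>I\<close> cannot be gathered by
  separation. Collection is applied to the full power set instead, with a formula that holds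
  trivially at the subsets which no tuple defines.

  Indiscernibility admits no parameters. Whatever it transfers must be a formula of \<open>K\<close>
  whose only arguments are elements of \<open>I\<close>: the tuple from \<open>V(i)\<close> is
  quantified inside it, which requires the hierarchy to be definable. Each \<open>V(i)\<close> must
  be a set for collection to range over it, and every set must be included in some level for a bound
  to become an ordinal; both come from a recursion theorem inside the model.\<close>

abbreviation lift :: "(nat \<Rightarrow> nat) \<Rightarrow> nat \<Rightarrow> nat" where
  "lift f \<equiv> \<lambda>v. case v of 0 \<Rightarrow> 0 | Suc m \<Rightarrow> Suc (f m)"

lemma lift_comp: "lift f \<circ> lift g = lift (f \<circ> g)"
  by (auto simp: fun_eq_iff split: nat.split)

lemma rename_rename: "rename f (rename g p) = rename (f \<circ> g) p"
  by (induction p arbitrary: f g) (simp_all add: lift_comp)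

lemma rename_cong: "(\<And>v. v \<in> fv p \<Longrightarrow> f v = g v) \<Longrightarrow> rename f p = rename g p"
proof (induction p arbitrary: f g)
  case (All p)
  have "rename (lift f) p = rename (lift g) p"
    by (rule All.IH) (use All.prems in \<open>auto split: nat.split\<close>)
  then show ?case by simp
next
  case (Imp p q)
  have "rename f p = rename g p" "rename f q = rename g q"
    by (rule Imp.IH, use Imp.prems in auto)+
  then show ?case by simp
qed auto

lemma lift_id: "lift (\<lambda>v. v) = (\<lambda>v. v)"
  by (auto simp: fun_eq_iff split: nat.split)

lemma rename_id: "rename (\<lambda>v. v) p = p"
  by (induction p) (simp_all add: lift_id)

lemma rename_closed: "fv p = {} \<Longrightarrow> rename f p = p"
  using rename_cong[of p f "\<lambda>v. v"] by (simp add: rename_id)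

lemma syms_rename [simp]: "syms (rename f p) = syms p"
  by (induction p arbitrary: f) simp_all

lemma fv_rename: "fv (rename f p) = f ` fv p"
proof (induction p arbitrary: f)
  case (All p)
  have "{v. Suc v \<in> lift f ` fv p} = f ` {v. Suc v \<in> fv p}"
  proof (intro equalityI subsetI)
    fix v assume "v \<in> {v. Suc v \<in> lift f ` fv p}"
    then obtain u where "u \<in> fv p" "Suc v = lift f u" by auto
    then show "v \<in> f ` {v. Suc v \<in> fv p}" by (cases u) auto
  qed force
  then show ?case by (simp add: All)
qed auto

lemma syms_inst [simp]: "syms (inst p t) = syms p"
  by (simp add: inst_def)

lemma rename_inst: "rename f (inst p a) = inst (rename (lift f) p) (f a)"
  unfolding inst_def rename_rename
  by (rule arg_cong[where f = "\<lambda>h. rename h p"]) (auto simp: fun_eq_iff split: nat.split)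

lemma inst_rename_lift: "inst (rename (lift f) p) t = rename (case_nat t f) p"
  unfolding inst_def rename_rename
  by (rule arg_cong[where f = "\<lambda>h. rename h p"]) (auto simp: fun_eq_iff split: nat.split)

lemma finite_fv: "finite (fv p)"
proof (induction p)
  case (All p)
  have "Suc ` {v. Suc v \<in> fv p} \<subseteq> fv p" by auto
  then have "finite (Suc ` {v. Suc v \<in> fv p})" using All finite_subset by blast
  then show ?case by (simp add: finite_image_iff)
qed auto

section \<open>Properties of derivability\<close>

lemma derives_mp: "(p \<^bold>\<longrightarrow> q) \<in> \<Gamma> \<Longrightarrow> p \<in> \<Gamma> \<Longrightarrow> derives L \<Gamma> q"
  by (rule derives.ImpE[OF derives.Assm derives.Assm])

lemma derives_weaken: "derives L \<Gamma> p \<Longrightarrow> \<Gamma> \<subseteq> \<Delta> \<Longrightarrow> derives L \<Delta> p"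
proof (induction arbitrary: \<Delta> rule: derives.induct)
  case (ImpI p \<Gamma> q)
  then show ?case by (meson derives.ImpI insert_mono)
next
  case (Contr p \<Gamma>)
  then show ?case by (meson derives.Contr insert_mono)
next
  case (AllI \<Gamma> p)
  then show ?case by (meson derives.AllI image_mono)
qed (blast intro: derives.intros)+

text \<open>The renaming need not be injective: the rules refer to variables only through
  \<open>inst\<close> and \<open>rename Suc\<close>, and both commute with renaming once
  \<open>f\<close> is lifted under the quantifier.\<close>

lemma derives_rename: "derives L \<Gamma> p \<Longrightarrow> derives L (rename f ` \<Gamma>) (rename f p)"
proof (induction arbitrary: f rule: derives.induct)
  case (AllI \<Gamma> p)
  have "rename (lift f) ` rename Suc ` \<Gamma> = rename Suc ` rename f ` \<Gamma>"
    by (simp add: image_image rename_rename comp_def)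
  then show ?case using AllI.IH[of "lift f"] by (auto intro: derives.AllI)
next
  case (AllE \<Gamma> p t)
  then show ?case using derives.AllE[of L "rename f ` \<Gamma>" "rename (lift f) p"]
    by (simp add: rename_inst)
next
  case (EqSubst \<Gamma> a b p)
  then show ?case using derives.EqSubst[of L "rename f ` \<Gamma>" "f a" "f b" "rename (lift f) p"]
    by (simp add: rename_inst)
next
  case (Contr p \<Gamma>)
  show ?case by (rule derives.Contr) (use Contr in \<open>simp_all add: Neg_def\<close>)
next
  case (ImpI p \<Gamma> q)
  then show ?case by (simp add: derives.ImpI)
next
  case (ImpE \<Gamma> p q)
  then show ?case using derives.ImpE[of L "rename f ` \<Gamma>" "rename f p"] by simp
qed (simp_all add: derives.Assm derives.EqRefl)

text \<open>Makes an inconsistency of the union of the Henkin stages visible at a single stage. In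
  the case \<open>AllI\<close> a finite part of the shifted context is the shift of a finite
  part.\<close>

lemma derives_finite: "derives L \<Gamma> p \<Longrightarrow> \<exists>\<Gamma>'. finite \<Gamma>' \<and> \<Gamma>' \<subseteq> \<Gamma> \<and> derives L \<Gamma>' p"
proof (induction rule: derives.induct)
  case (Assm p \<Gamma>)
  then show ?case by (intro exI[of _ "{p}"]) (auto intro: derives.Assm)
next
  case (ImpI p \<Gamma> q)
  then obtain X where X: "finite X" "X \<subseteq> insert p \<Gamma>" "derives L X q" by blast
  then have "derives L (insert p (X - {p})) q" by (auto intro: derives_weaken)
  then show ?case using X ImpI.hyps by (intro exI[of _ "X - {p}"]) (auto intro: derives.ImpI)
next
  case (ImpE \<Gamma> p q)
  then obtain X Y where "finite X" "X \<subseteq> \<Gamma>" "derives L X (p \<^bold>\<longrightarrow> q)"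
    "finite Y" "Y \<subseteq> \<Gamma>" "derives L Y p" by blast
  then show ?case
    by (intro exI[of _ "X \<union> Y"]) (auto intro: derives.ImpE[of _ _ p] derives_weaken)
next
  case (Contr p \<Gamma>)
  then obtain X where X: "finite X" "X \<subseteq> insert (Neg p) \<Gamma>" "derives L X Bot" by blast
  then have "derives L (insert (Neg p) (X - {Neg p})) Bot" by (auto intro: derives_weaken)
  then show ?case using X Contr.hyps
    by (intro exI[of _ "X - {Neg p}"]) (auto intro: derives.Contr)
next
  case (AllI \<Gamma> p)
  then obtain X where X: "finite X" "X \<subseteq> rename Suc ` \<Gamma>" "derives L X p" by blast
  then obtain Y where "Y \<subseteq> \<Gamma>" "finite Y" "X = rename Suc ` Y"
    using finite_subset_image by metis
  then show ?case using X by (intro exI[of _ Y]) (auto intro: derives.AllI)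
next
  case (AllE \<Gamma> p t)
  then show ?case by (blast intro: derives.AllE)
next
  case (EqRefl \<Gamma> a)
  then show ?case by (intro exI[of _ "{}"]) (auto intro: derives.EqRefl)
next
  case (EqSubst \<Gamma> a b p)
  then obtain X Y where "finite X" "X \<subseteq> \<Gamma>" "derives L X (a \<^bold>= b)"
    "finite Y" "Y \<subseteq> \<Gamma>" "derives L Y (inst p a)" by blast
  then show ?case
    by (intro exI[of _ "X \<union> Y"]) (auto intro: derives.EqSubst[of _ _ a] derives_weaken)
qed

text \<open>The renaming \<open>?f\<close> moves \<open>t\<close> to 0 and shifts all other
  variables. On the context, where \<open>t\<close> is not free, it acts as \<open>Suc\<close>, and
  it turns \<open>inst p t\<close> back into \<open>p\<close>, so that \<open>AllI\<close>
  applies.\<close>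

lemma derives_generalize:
  assumes "derives L \<Gamma> (inst p t)" and t: "\<And>q. q \<in> \<Gamma> \<Longrightarrow> t \<notin> fv q" "t \<notin> fv (All p)"
  shows "derives L \<Gamma> (All p)"
proof (rule derives.AllI)
  let ?f = "\<lambda>v. if v = t then 0 else Suc v"
  have "rename ?f q = rename Suc q" if "q \<in> \<Gamma>" for q
    using t(1)[OF that] by (intro rename_cong) auto
  then have "rename ?f ` \<Gamma> = rename Suc ` \<Gamma>" by (rule image_cong[OF refl])
  moreover have "rename ?f (inst p t) = rename (\<lambda>v. v) p"
    unfolding inst_def rename_rename
    by (rule rename_cong) (use t(2) in \<open>auto split: nat.split\<close>)
  ultimately show "derives L (rename Suc ` \<Gamma>) p"
    using derives_rename[OF assms(1), of ?f] by (simp add: rename_id)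
qed

section \<open>Semantics and completeness\<close>

definition scons :: "'a \<Rightarrow> (nat \<Rightarrow> 'a) \<Rightarrow> nat \<Rightarrow> 'a"  (infixr "\<cdot>" 65) where
  "x \<cdot> e = case_nat x e"

lemma scons_simps [simp]:
  "(x \<cdot> e) 0 = x" "(x \<cdot> e) (Suc n) = e n"
  "(x \<cdot> e) (numeral k) = e (pred_numeral k)" "(x \<cdot> e) (n + numeral k) = e (n + pred_numeral k)"
  by (simp_all add: scons_def numeral_eq_Suc)

text \<open>\<open>Q\<close> interprets equality, so that the term model can be used before factoring out provable equality.\<close>

primrec sat_eq ::
  "('a \<Rightarrow> 'a \<Rightarrow> bool) \<Rightarrow> ('a \<Rightarrow> 'a \<Rightarrow> bool) \<Rightarrow> ('a \<Rightarrow> 'a \<Rightarrow> bool) \<Rightarrow> ('a \<Rightarrow> bool) \<Rightarrow> (nat \<Rightarrow> 'a) \<Rightarrow> fm \<Rightarrow> bool"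
  where
  "sat_eq Q E R I e (a \<^bold>= b) = Q (e a) (e b)"
| "sat_eq Q E R I e (a \<^bold>\<in> b) = E (e a) (e b)"
| "sat_eq Q E R I e (a \<^bold>< b) = R (e a) (e b)"
| "sat_eq Q E R I e (InI a) = I (e a)"
| "sat_eq Q E R I e Bot = False"
| "sat_eq Q E R I e (p \<^bold>\<longrightarrow> q) = (sat_eq Q E R I e p \<longrightarrow> sat_eq Q E R I e q)"
| "sat_eq Q E R I e (All p) = (\<forall>x. sat_eq Q E R I (x \<cdot> e) p)"

lemma sat_Neg [simp]: "sat_eq Q E R I e (Neg p) = (\<not> sat_eq Q E R I e p)"
  by (simp add: Neg_def)

lemma sat_Top [simp]: "sat_eq Q E R I e Top"
  by (simp add: Top_def)

lemma sat_Or [simp]: "sat_eq Q E R I e (p \<^bold>\<or> q) = (sat_eq Q E R I e p \<or> sat_eq Q E R I e q)"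
  by (auto simp: Or_def)

lemma sat_And [simp]: "sat_eq Q E R I e (p \<^bold>\<and> q) = (sat_eq Q E R I e p \<and> sat_eq Q E R I e q)"
  by (auto simp: And_def)

lemma sat_Iff [simp]: "sat_eq Q E R I e (p \<^bold>\<longleftrightarrow> q) = (sat_eq Q E R I e p = sat_eq Q E R I e q)"
  by (auto simp: Iff_def)

lemma sat_Ex [simp]: "sat_eq Q E R I e (Ex p) = (\<exists>x. sat_eq Q E R I (x \<cdot> e) p)"
  by (simp add: Ex_def)

lemma sat_BAll [simp]:
  "sat_eq Q E R I e (BAll v p) = (\<forall>x. E x (e v) \<longrightarrow> sat_eq Q E R I (x \<cdot> e) p)"
  by (simp add: BAll_def)

lemma sat_BEx [simp]:
  "sat_eq Q E R I e (BEx v p) = (\<exists>x. E x (e v) \<and> sat_eq Q E R I (x \<cdot> e) p)"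
  by (simp add: BEx_def)

lemma sat_rename: "sat_eq Q E R I e (rename f p) = sat_eq Q E R I (\<lambda>v. e (f v)) p"
proof (induction p arbitrary: e f)
  case (All p)
  have "(\<lambda>v. (x \<cdot> e) (lift f v)) = x \<cdot> (\<lambda>v. e (f v))" for x
    by (auto simp: fun_eq_iff scons_def split: nat.split)
  then show ?case unfolding rename.simps sat_eq.simps All by simp
qed simp_all

text \<open>Here \<open>\<cdot>\<close> doubles as a renaming: a formula with two distinguished
  arguments is reused below other quantifiers by sending these arguments to \<open>a\<close> and
  \<open>b\<close> and shifting its parameters.\<close>

lemma sat_rename_scons:
  "sat_eq Q E R I e (rename (a \<cdot> b \<cdot> f) p) = sat_eq Q E R I (e a \<cdot> e b \<cdot> (\<lambda>v. e (f v))) p"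
proof -
  have "(\<lambda>v. e ((a \<cdot> b \<cdot> f) v)) = e a \<cdot> e b \<cdot> (\<lambda>v. e (f v))"
    by (auto simp: fun_eq_iff scons_def split: nat.split)
  then show ?thesis by (simp add: sat_rename)
qed

lemma sat_cong:
  "(\<And>v. v \<in> fv p \<Longrightarrow> e v = e' v) \<Longrightarrow> sat_eq Q E R I e p = sat_eq Q E R I e' p"
proof (induction p arbitrary: e e')
  case (All p)
  have "sat_eq Q E R I (x \<cdot> e) p = sat_eq Q E R I (x \<cdot> e') p" for x
    by (rule All.IH) (use All.prems in \<open>auto simp: scons_def split: nat.split\<close>)
  then show ?case by simp
next
  case (Imp p q)
  have "sat_eq Q E R I e p = sat_eq Q E R I e' p"
    by (rule Imp.IH(1)) (use Imp.prems in auto)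
  moreover have "sat_eq Q E R I e q = sat_eq Q E R I e' q"
    by (rule Imp.IH(2)) (use Imp.prems in auto)
  ultimately show ?case by simp
qed auto

text \<open>Transfers truth from the term model to its quotient. As \<open>Q\<close> is an arbitrary
  relation, \<open>h\<close> may identify terms; surjectivity handles the quantifier.\<close>

lemma sat_surj:
  assumes "surj h" and "\<And>x y. Q' (h x) (h y) = Q x y" "\<And>x y. E' (h x) (h y) = E x y"
    and "\<And>x y. R' (h x) (h y) = R x y" "\<And>x. I' (h x) = I x"
  shows "sat_eq Q' E' R' I' (\<lambda>v. h (e v)) p = sat_eq Q E R I e p"
proof (induction p arbitrary: e)
  case (All p)
  have h: "h x \<cdot> (\<lambda>v. h (e v)) = (\<lambda>v. h ((x \<cdot> e) v))" for x
    by (auto simp: fun_eq_iff scons_def split: nat.split)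
  have "(\<forall>y. sat_eq Q' E' R' I' (y \<cdot> (\<lambda>v. h (e v))) p)
      = (\<forall>x. sat_eq Q' E' R' I' ((h x) \<cdot> (\<lambda>v. h (e v))) p)"
    using assms(1) by (metis surjD)
  then show ?case unfolding sat_eq.simps h All .
qed (simp_all add: assms)

section \<open>Henkin stages\<close>

instance fm :: countable
  by countable_datatype

text \<open>Witnesses are variables rather than new constants. The context \<open>\<Gamma>\<close>
  will consist of sentences and \<open>S\<close> stays finite, so some variable is free in neither;
  this is why \<open>\<Gamma>\<close> is kept outside \<open>S\<close>. The comprehension is a
  singleton or empty.\<close>

definition extend :: "sym set \<Rightarrow> fm set \<Rightarrow> fm \<Rightarrow> fm set \<Rightarrow> fm set" where
  "extend L \<Gamma> p S =
    (if syms p \<subseteq> L \<and> \<not> derives L (\<Gamma> \<union> insert p S) Bot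
     then insert p S \<union>
       {Neg (inst q t) | q t. p = Neg (All q) \<and> t = (SOME t. \<forall>s \<in> insert p S. t \<notin> fv s)}
     else S)"

primrec stage :: "sym set \<Rightarrow> fm set \<Rightarrow> fm \<Rightarrow> nat \<Rightarrow> fm set" where
  "stage L \<Gamma> p 0 = {p}"
| "stage L \<Gamma> p (Suc n) = extend L \<Gamma> (from_nat n) (stage L \<Gamma> p n)"

definition henkin_set :: "sym set \<Rightarrow> fm set \<Rightarrow> fm \<Rightarrow> fm set" where
  "henkin_set L \<Gamma> p = \<Gamma> \<union> (\<Union>n. stage L \<Gamma> p n)"

lemma Neg_inject: "Neg p = Neg q \<longleftrightarrow> p = q"
  by (simp add: Neg_def)

lemma extend_finite: "finite S \<Longrightarrow> finite (extend L \<Gamma> p S)"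
proof -
  have "finite {Neg (inst q t) | q t. p = Neg (All q) \<and> t = c}" for c
    by (rule finite_subset[of _ "{Neg (inst (THE q. p = Neg (All q)) c)}"])
      (auto simp: Neg_inject)
  then show "finite S \<Longrightarrow> finite (extend L \<Gamma> p S)" by (simp add: extend_def)
qed

lemma extend_mono: "S \<subseteq> extend L \<Gamma> p S"
  by (auto simp: extend_def)

lemma fresh_exists:
  assumes "finite S"
  shows "\<forall>s \<in> S. (SOME t. \<forall>s \<in> S. t \<notin> fv s) \<notin> fv s"
proof (rule someI_ex)
  have "finite (\<Union> (fv ` S))" using assms finite_fv by blast
  then obtain t where "t \<notin> \<Union> (fv ` S)" using ex_new_if_finite infinite_UNIV_nat by blast
  then show "\<exists>t. \<forall>s \<in> S. t \<notin> fv s" by blast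
qed

text \<open>Adding the witness is harmless: if it led to a contradiction, \<open>inst q t\<close>
  would be derivable for a fresh \<open>t\<close>, hence also \<open>All q\<close>, against the
  formula \<open>Neg (All q)\<close> added with it.\<close>

lemma extend_consistent:
  assumes "finite S" and closed: "\<And>q. q \<in> \<Gamma> \<Longrightarrow> fv q = {}"
    and con: "\<not> derives L (\<Gamma> \<union> S) Bot"
  shows "\<not> derives L (\<Gamma> \<union> extend L \<Gamma> p S) Bot"
proof (cases "syms p \<subseteq> L \<and> \<not> derives L (\<Gamma> \<union> insert p S) Bot")
  case True
  let ?t = "SOME t. \<forall>s \<in> insert p S. t \<notin> fv s"
  show ?thesis
  proof (cases "\<exists>q. p = Neg (All q)")
    case False
    then have "extend L \<Gamma> p S = insert p S" using True by (auto simp: extend_def)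
    then show ?thesis using True by simp
  next
    case Q: True
    then obtain q where q: "p = Neg (All q)" by blast
    have ext: "extend L \<Gamma> p S = insert (Neg (inst q ?t)) (insert p S)"
      using True by (auto simp: extend_def q Neg_inject)
    have fresh: "\<forall>s \<in> insert p S. ?t \<notin> fv s"
      by (rule fresh_exists) (use assms(1) in simp)
    show ?thesis
    proof
      assume "derives L (\<Gamma> \<union> extend L \<Gamma> p S) Bot"
      then have "derives L (insert (Neg (inst q ?t)) (\<Gamma> \<union> insert p S)) Bot" by (simp add: ext)
      moreover have "syms (inst q ?t) \<subseteq> L" using True by (simp add: q Neg_def)
      ultimately have "derives L (\<Gamma> \<union> insert p S) (inst q ?t)" by (rule derives.Contr[rotated])
      moreover have "?t \<notin> fv s" if "s \<in> \<Gamma> \<union> insert p S" for s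
        using that fresh closed by auto
      moreover have "?t \<notin> fv (All q)" using fresh by (simp add: q Neg_def)
      ultimately have "derives L (\<Gamma> \<union> insert p S) (All q)" by (rule derives_generalize)
      moreover have "derives L (\<Gamma> \<union> insert p S) (Neg (All q))" by (rule derives.Assm) (simp add: q)
      ultimately show False using True by (auto simp: Neg_def intro: derives.ImpE)
    qed
  qed
next
  case False
  then have "extend L \<Gamma> p S = S" unfolding extend_def by (rule if_not_P)
  then show ?thesis using con by simp
qed

section \<open>The Henkin set and its term model\<close>

locale henkin =
  fixes L :: "sym set" and \<Gamma> :: "fm set" and p0 :: fm
  assumes closed: "q \<in> \<Gamma> \<Longrightarrow> fv q = {}"
    and syms_p0: "syms p0 \<subseteq> L"
    and unprovable: "\<not> derives L \<Gamma> p0"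
begin

abbreviation "S \<equiv> stage L \<Gamma> (Neg p0)"
abbreviation "H \<equiv> henkin_set L \<Gamma> (Neg p0)"

lemma stage_finite: "finite (S n)"
  by (induction n) (simp_all add: extend_finite)

lemma stage_consistent: "\<not> derives L (\<Gamma> \<union> S n) Bot"
proof (induction n)
  case 0
  then show ?case using unprovable syms_p0 by (auto intro: derives.Contr)
next
  case (Suc n)
  then show ?case using extend_consistent[OF stage_finite closed] by simp
qed

lemma stage_mono: "m \<le> n \<Longrightarrow> S m \<subseteq> S n"
  using lift_Suc_mono_le[of S] extend_mono by simp

lemma finite_stage: "finite X \<Longrightarrow> X \<subseteq> H \<Longrightarrow> \<exists>n. X \<subseteq> \<Gamma> \<union> S n"
proof (induction rule: finite_induct)
  case (insert x F)
  then obtain n where n: "F \<subseteq> \<Gamma> \<union> S n" by auto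
  show ?case
  proof (cases "x \<in> \<Gamma>")
    case True
    then show ?thesis using n by blast
  next
    case False
    then obtain m where m: "x \<in> S m" using insert.prems by (auto simp: henkin_set_def)
    have "x \<in> S (max m n)" "S n \<subseteq> S (max m n)" using m stage_mono[of m "max m n"] stage_mono[of n "max m n"] by auto
    then show ?thesis using n by (intro exI[of _ "max m n"]) auto
  qed
qed simp

lemma consistent: "\<not> derives L H Bot"
proof
  assume "derives L H Bot"
  then have "\<exists>X. finite X \<and> X \<subseteq> H \<and> derives L X Bot" by (rule derives_finite)
  then obtain X where X: "finite X" "X \<subseteq> H" "derives L X Bot" by blast
  obtain n where "X \<subseteq> \<Gamma> \<union> S n" using finite_stage[OF X(1,2)] by blast
  then show False using stage_consistent[of n] derives_weaken[OF X(3)] by blast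
qed

lemma stage_subset: "\<Gamma> \<union> S n \<subseteq> H"
  by (auto simp: henkin_set_def)

text \<open>Every formula has its turn at the stage numbered by its code. A formula of
  \<open>L\<close> that \<open>H\<close> derives is consistent with that stage and is therefore
  added there.\<close>

lemma derives_iff: 
  assumes "syms p \<subseteq> L" shows "p \<in> H \<longleftrightarrow> derives L H p"
proof
  assume d: "derives L H p"
  define n where "n = to_nat p"
  have n: "from_nat n = p" by (simp add: n_def)
  have "\<not> derives L (\<Gamma> \<union> insert p (S n)) Bot"
  proof
    assume "derives L (\<Gamma> \<union> insert p (S n)) Bot"
    then have "derives L (insert p H) Bot"
      by (rule derives_weaken) (use stage_subset[of n] in auto)
    then have "derives L H (p \<^bold>\<longrightarrow> Bot)" using assms by (rule derives.ImpI[rotated])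
    then show False using d consistent derives.ImpE by blast
  qed
  then have "p \<in> S (Suc n)" using assms by (simp add: n extend_def)
  then show "p \<in> H" using stage_subset[of "Suc n"] by blast
next
  assume "p \<in> H"
  then show "derives L H p" by (rule derives.Assm)
qed

text \<open>A formula outside \<open>H\<close> was rejected at its turn, so that stage together with
  \<open>\<Gamma>\<close> refutes it; then \<open>H\<close> derives the negation and contains
  it.\<close>

lemma Neg_iff: assumes "syms p \<subseteq> L" shows "Neg p \<in> H \<longleftrightarrow> p \<notin> H"
proof
  assume "Neg p \<in> H"
  then show "p \<notin> H" using consistent derives_mp[of p Bot H L] unfolding Neg_def by blast
next
  assume "p \<notin> H"
  define n where "n = to_nat p"
  have n: "from_nat n = p" by (simp add: n_def)
  have "p \<notin> S (Suc n)" using \<open>p \<notin> H\<close> stage_subset[of "Suc n"] by blast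
  then have "derives L (\<Gamma> \<union> insert p (S n)) Bot"
    using assms by (auto simp: n extend_def split: if_splits)
  then have "derives L (insert p H) Bot"
    by (rule derives_weaken) (use stage_subset[of n] in auto)
  then have "derives L H (Neg p)" unfolding Neg_def using assms by (rule derives.ImpI[rotated])
  then show "Neg p \<in> H" using derives_iff[of "Neg p"] assms by (simp add: Neg_def)
qed

lemma Bot_iff: "Bot \<notin> H"
  using consistent derives.Assm by blast

lemma Imp_iff: 
  assumes "syms p \<subseteq> L" "syms q \<subseteq> L" shows "(p \<^bold>\<longrightarrow> q) \<in> H \<longleftrightarrow> (p \<in> H \<longrightarrow> q \<in> H)"
proof
  assume "(p \<^bold>\<longrightarrow> q) \<in> H"
  then show "p \<in> H \<longrightarrow> q \<in> H" using derives_iff[OF assms(2)] derives_mp[of p q H L] by blast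
next
  assume r: "p \<in> H \<longrightarrow> q \<in> H"
  have "derives L (insert p H) q"
  proof (cases "q \<in> H")
    case True
    then show ?thesis by (auto intro: derives.Assm)
  next
    case False
    then have "Neg p \<in> H" using r Neg_iff assms by blast
    then have "derives L (insert p H) Bot"
      using derives_mp[of p Bot "insert p H" L] by (auto simp: Neg_def)
    then have "derives L (insert (Neg q) (insert p H)) Bot" by (rule derives_weaken) auto
    then show ?thesis by (rule derives.Contr[OF assms(2)])
  qed
  then have "derives L H (p \<^bold>\<longrightarrow> q)" by (rule derives.ImpI[OF assms(1)])
  then show "(p \<^bold>\<longrightarrow> q) \<in> H" using derives_iff assms by simp
qed

text \<open>If \<open>All p\<close> is missing, its negation lies in \<open>H\<close>, and the
  witness added at the turn of the negation contradicts one of the instances.\<close>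

lemma All_iff: assumes "syms p \<subseteq> L" shows "All p \<in> H \<longleftrightarrow> (\<forall>t. inst p t \<in> H)"
proof
  show "All p \<in> H \<Longrightarrow> \<forall>t. inst p t \<in> H"
    using derives_iff[of "inst p _"] assms derives.AllE[OF derives.Assm] by simp
  assume r: "\<forall>t. inst p t \<in> H"
  show "All p \<in> H"
  proof (rule ccontr)
    assume "All p \<notin> H"
    then have N: "Neg (All p) \<in> H" using Neg_iff[of "All p"] assms by simp
    define n where "n = to_nat (Neg (All p))"
    have n: "from_nat n = Neg (All p)" by (simp add: n_def)
    have "\<not> derives L (\<Gamma> \<union> insert (Neg (All p)) (S n)) Bot"
      using consistent derives_weaken N stage_subset[of n]
      by (metis Un_insert_right insert_subset)
    then have "\<exists>t. Neg (inst p t) \<in> S (Suc n)"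
      using assms by (auto simp: n extend_def Neg_def)
    then obtain t where "Neg (inst p t) \<in> H" using stage_subset[of "Suc n"] by blast
    then show False using Neg_iff r assms by simp
  qed
qed

lemma Eq_refl: "(a \<^bold>= a) \<in> H"
  by (simp add: derives_iff derives.EqRefl)

lemma Eq_subst:
  assumes "(a \<^bold>= b) \<in> H" "inst p a \<in> H" "syms p \<subseteq> L" shows "inst p b \<in> H"
  using derives.EqSubst[of L H a b p] assms derives_iff[of "inst p b"] derives.Assm by simp

lemma Eq_sym: "(a \<^bold>= b) \<in> H \<Longrightarrow> (b \<^bold>= a) \<in> H"
  using Eq_subst[of a b "0 \<^bold>= Suc a"] Eq_refl by (simp add: inst_def)

lemma Eq_trans: "(a \<^bold>= b) \<in> H \<Longrightarrow> (b \<^bold>= c) \<in> H \<Longrightarrow> (a \<^bold>= c) \<in> H"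
  using Eq_subst[of b c "Suc a \<^bold>= 0"] by (simp add: inst_def)

lemma Mem_cong: 
  assumes "(a \<^bold>= a') \<in> H" "(b \<^bold>= b') \<in> H" "(a \<^bold>\<in> b) \<in> H" shows "(a' \<^bold>\<in> b') \<in> H"
  using assms Eq_subst[of a a' "0 \<^bold>\<in> Suc b"] Eq_subst[of b b' "Suc a' \<^bold>\<in> 0"] by (simp add: inst_def)

lemma Less_cong: 
  assumes "(a \<^bold>= a') \<in> H" "(b \<^bold>= b') \<in> H" "(a \<^bold>< b) \<in> H" "LessSym \<in> L" shows "(a' \<^bold>< b') \<in> H"
  using assms Eq_subst[of a a' "0 \<^bold>< Suc b"] Eq_subst[of b b' "Suc a' \<^bold>< 0"] by (simp add: inst_def)

lemma InI_cong: "(a \<^bold>= a') \<in> H \<Longrightarrow> InI a \<in> H \<Longrightarrow> ISym \<in> L \<Longrightarrow> InI a' \<in> H"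
  using Eq_subst[of a a' "InI 0"] by (simp add: inst_def)

text \<open>The elements are the variables themselves. A symbol outside \<open>L\<close> denotes the
  empty relation, because congruence under provable equality is available only for formulae of
  \<open>L\<close>.\<close>

abbreviation "term_sat \<equiv> sat_eq (\<lambda>a b. (a \<^bold>= b) \<in> H) (\<lambda>a b. (a \<^bold>\<in> b) \<in> H)
  (\<lambda>a b. LessSym \<in> L \<and> (a \<^bold>< b) \<in> H) (\<lambda>a. ISym \<in> L \<and> InI a \<in> H)"

text \<open>Since an environment of the term model is itself a renaming, extending it by a variable
  matches instantiating the renamed body at that variable; \<open>All_iff\<close> then settles the
  quantifier.\<close>

lemma truth: "syms p \<subseteq> L \<Longrightarrow> term_sat e p \<longleftrightarrow> rename e p \<in> H"
  by (induction p arbitrary: e) (simp_all add: Bot_iff Imp_iff All_iff inst_rename_lift scons_def)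

lemma term_sat_axiom: "q \<in> \<Gamma> \<Longrightarrow> syms q \<subseteq> L \<Longrightarrow> term_sat e q"
  using truth[of q e] rename_closed[OF closed, of q e] stage_subset[of 0] by auto

lemma term_refutes: "\<not> term_sat (\<lambda>v. v) p0"
proof -
  have "Neg p0 \<in> S 0" by simp
  then have "Neg p0 \<in> H" using stage_subset[of 0] by blast
  then show ?thesis using Neg_iff truth[OF syms_p0, of "\<lambda>v. v"] syms_p0 by (simp add: rename_id)
qed

lemma class_eq_iff: "{c. (a \<^bold>= c) \<in> H} = {c. (b \<^bold>= c) \<in> H} \<longleftrightarrow> (a \<^bold>= b) \<in> H"
proof
  assume "{c. (a \<^bold>= c) \<in> H} = {c. (b \<^bold>= c) \<in> H}"
  then have "(a \<^bold>= b) \<in> H \<longleftrightarrow> (b \<^bold>= b) \<in> H" by (simp add: set_eq_iff)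
  then show "(a \<^bold>= b) \<in> H" using Eq_refl by simp
next
  assume "(a \<^bold>= b) \<in> H"
  then show "{c. (a \<^bold>= c) \<in> H} = {c. (b \<^bold>= c) \<in> H}"
    by (auto intro: Eq_trans[of a b] Eq_trans[of b a] Eq_sym[of a b])
qed

text \<open>
  Forming singletons is injective and misses the empty set. So the quotient of the term model can be
  identified with the type of natural numbers, and satisfaction never has to be relativized to a domain.
\<close>
lemma infinite_quotient:
  assumes "Pairing \<in> \<Gamma>" "Infinity \<in> \<Gamma>"
  shows "infinite (range (\<lambda>a. {b. (a \<^bold>= b) \<in> H}))" (is "infinite (range ?c)")
proof
  note c = class_eq_iff
  assume fin: "finite (range ?c)"
  have "term_sat (\<lambda>v. v) Pairing" using assms
    by (intro term_sat_axiom) (auto simp: Pairing_def IsUPair_def Iff_def And_def Neg_def Or_def Ex_def)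
  then have "\<forall>a. \<exists>u. \<forall>z. (z \<^bold>\<in> u) \<in> H \<longleftrightarrow> (z \<^bold>= a) \<in> H"
    by (force simp: Pairing_def IsUPair_def)
  then obtain s where s: "\<And>a z. (z \<^bold>\<in> s a) \<in> H \<longleftrightarrow> (z \<^bold>= a) \<in> H" by metis
  have "term_sat (\<lambda>v. v) Infinity" using assms
    by (intro term_sat_axiom)
      (auto simp: Infinity_def IsSucc_def Iff_def And_def Neg_def Or_def Ex_def BEx_def BAll_def Nonempty_def)
  then obtain z0 where z0: "\<And>z. (z \<^bold>\<in> z0) \<notin> H"
    by (auto simp: Infinity_def Nonempty_def)
  define rep where "rep X = (SOME a. ?c a = X)" for X
  have rep: "?c (rep (?c a)) = ?c a" for a
    unfolding rep_def by (rule someI) (rule refl)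
  have "inj_on (\<lambda>X. ?c (s (rep X))) (range ?c)"
  proof (rule inj_onI)
    fix X Y assume X: "X \<in> range ?c" and Y: "Y \<in> range ?c" and eq: "?c (s (rep X)) = ?c (s (rep Y))"
    have "(rep X \<^bold>\<in> s (rep X)) \<in> H" using s Eq_refl by blast
    then have "(rep X \<^bold>\<in> s (rep Y)) \<in> H" using Mem_cong[OF Eq_refl eq[unfolded c]] by simp
    then have "?c (rep X) = ?c (rep Y)" using s c by blast
    then show "X = Y" using X Y rep by auto
  qed
  moreover have "(\<lambda>X. ?c (s (rep X))) ` range ?c \<subseteq> range ?c" by auto
  ultimately have "(\<lambda>X. ?c (s (rep X))) ` range ?c = range ?c"
    using fin endo_inj_surj by metis
  then have "?c z0 \<in> (\<lambda>X. ?c (s (rep X))) ` range ?c" by simp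
  then obtain X where "?c z0 = ?c (s (rep X))" by (rule imageE)
  then obtain a where "(s a \<^bold>= z0) \<in> H" unfolding c using Eq_sym[of z0] by blast
  then show False using Mem_cong[OF Eq_refl, of "s a" z0 a] s[of a a] Eq_refl[of a] z0 by simp
qed

end

text \<open>The premise \<open>valid\<close> cannot range over all types, so it ranges over
  structures on \<open>nat\<close>. Pairing and Infinity make the quotient of the term model
  countably infinite, so that it can be copied there.\<close>

theorem completeness:
  assumes closed: "\<And>q. q \<in> \<Gamma> \<Longrightarrow> fv q = {}" and syms: "\<And>q. q \<in> \<Gamma> \<Longrightarrow> syms q \<subseteq> L"
    and p: "syms p \<subseteq> L" and inf: "Pairing \<in> \<Gamma>" "Infinity \<in> \<Gamma>"
    and valid: "\<And>(E :: nat \<Rightarrow> nat \<Rightarrow> bool) R I e.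
      (\<And>q e. q \<in> \<Gamma> \<Longrightarrow> sat_eq (=) E R I e q) \<Longrightarrow> sat_eq (=) E R I e p"
  shows "derives L \<Gamma> p"
proof (rule ccontr)
  assume "\<not> derives L \<Gamma> p"
  then interpret henkin L \<Gamma> p using closed p by unfold_locales auto
  let ?c = "\<lambda>a. {b. (a \<^bold>= b) \<in> H}"
  have "countable (range ?c)" by simp
  then obtain f :: "nat set \<Rightarrow> nat" where f: "bij_betw f (range ?c) UNIV"
    using countableE_infinite infinite_quotient[OF inf] by metis
  define h where "h = f \<circ> ?c"
  have "surj h" using f unfolding h_def bij_betw_def image_comp[symmetric] by simp
  have h: "h a = h b \<longleftrightarrow> (a \<^bold>= b) \<in> H" for a b
    using f inj_on_eq_iff[of f "range ?c" "?c a" "?c b"] class_eq_iff[of a b]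
    by (simp add: h_def bij_betw_def)
  define E where "E x y = (\<exists>a b. x = h a \<and> y = h b \<and> (a \<^bold>\<in> b) \<in> H)" for x y
  define R where "R x y = (\<exists>a b. x = h a \<and> y = h b \<and> LessSym \<in> L \<and> (a \<^bold>< b) \<in> H)" for x y
  define I where "I x = (\<exists>a. x = h a \<and> ISym \<in> L \<and> InI a \<in> H)" for x
  have E: "E (h a) (h b) \<longleftrightarrow> (a \<^bold>\<in> b) \<in> H" for a b
    unfolding E_def h using Mem_cong[OF Eq_sym Eq_sym, of a _ b] Eq_refl by blast
  have R: "R (h a) (h b) \<longleftrightarrow> LessSym \<in> L \<and> (a \<^bold>< b) \<in> H" for a b
    unfolding R_def h using Less_cong[OF Eq_sym Eq_sym, of a _ b] Eq_refl by blast
  have I: "I (h a) \<longleftrightarrow> ISym \<in> L \<and> InI a \<in> H" for a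
    unfolding I_def h using InI_cong[OF Eq_sym, of a] Eq_refl by blast
  have sat: "sat_eq (=) E R I (\<lambda>v. h (e v)) q = term_sat e q" for e q
    by (rule sat_surj[OF \<open>surj h\<close>]) (fact h E R I)+
  have "sat_eq (=) E R I e q" if "q \<in> \<Gamma>" for q e
  proof -
    have "sat_eq (=) E R I (\<lambda>v. h v) q" unfolding sat by (rule term_sat_axiom[OF that syms[OF that]])
    then show ?thesis using sat_cong[of q e "\<lambda>v. h v"] closed[OF that] by auto
  qed
  then have "sat_eq (=) E R I (\<lambda>v. h v) p" by (rule valid)
  then show False using term_refutes unfolding sat by blast
qed

section \<open>Semantics of the defined formulae\<close>

lemma syms_Neg [simp]: "syms (Neg p) = syms p" by (simp add: Neg_def)
lemma syms_Top [simp]: "syms Top = {}" by (simp add: Top_def)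
lemma syms_Or [simp]: "syms (p \<^bold>\<or> q) = syms p \<union> syms q" by (simp add: Or_def)
lemma syms_And [simp]: "syms (p \<^bold>\<and> q) = syms p \<union> syms q" by (simp add: And_def)
lemma syms_Iff [simp]: "syms (p \<^bold>\<longleftrightarrow> q) = syms p \<union> syms q" by (auto simp: Iff_def)
lemma syms_Ex [simp]: "syms (Ex p) = syms p" by (simp add: Ex_def)
lemma syms_BAll [simp]: "syms (BAll v p) = syms p" by (simp add: BAll_def)
lemma syms_BEx [simp]: "syms (BEx v p) = syms p" by (simp add: BEx_def)
lemma syms_Alls [simp]: "syms (Alls n p) = syms p" by (induction n) (simp_all add: Alls_def)
lemma syms_Conj [simp]: "syms (Conj ps) = \<Union> (syms ` set ps)"
  by (induction ps) (simp_all add: Conj_def)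
lemma syms_app [simp]: "syms (app p vs) = syms p" by (simp add: app_def)

lemma syms_set_notions [simp]:
  "syms (Sub a b) = {}" "syms (Nonempty a) = {}" "syms (IsSucc a b) = {}" "syms (IsUPair c a b) = {}"
  "syms (IsOPair c a b) = {}" "syms (Maps c a b) = {}" "syms (Ord a) = {}" "syms (IsV a b) = {}"
  "syms (InV a b) = {}"
  by (simp_all add: Sub_def Nonempty_def IsSucc_def IsUPair_def IsOPair_def Maps_def Ord_def IsV_def InV_def)

lemma sat_Conj [simp]: "sat_eq Q E R I e (Conj ps) = (\<forall>p \<in> set ps. sat_eq Q E R I e p)"
  by (induction ps) (simp_all add: Conj_def)

section \<open>Semantic counterparts of the set-theoretic formulae\<close>

locale interpretation_of_symbols =
  fixes E :: "'a \<Rightarrow> 'a \<Rightarrow> bool"  (infix "\<epsilon>" 50)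
    and R :: "'a \<Rightarrow> 'a \<Rightarrow> bool" and I :: "'a \<Rightarrow> bool"
begin

abbreviation sat :: "(nat \<Rightarrow> 'a) \<Rightarrow> fm \<Rightarrow> bool" where
  "sat \<equiv> sat_eq (=) E R I"

definition sub :: "'a \<Rightarrow> 'a \<Rightarrow> bool" where
  "sub x y = (\<forall>z. z \<epsilon> x \<longrightarrow> z \<epsilon> y)"

definition opair :: "'a \<Rightarrow> 'a \<Rightarrow> 'a \<Rightarrow> bool" where
  "opair p a b = (\<exists>s d. (\<forall>z. z \<epsilon> s \<longleftrightarrow> z = a) \<and> (\<forall>z. z \<epsilon> d \<longleftrightarrow> z = a \<or> z = b) \<and>
    (\<forall>z. z \<epsilon> p \<longleftrightarrow> z = s \<or> z = d))"

definition maps :: "'a \<Rightarrow> 'a \<Rightarrow> 'a \<Rightarrow> bool" where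
  "maps f a b = (\<exists>p. p \<epsilon> f \<and> opair p a b)"

text \<open>With Foundation the other clauses of \<open>Ord\<close> follow: membership has no short
  cycles, so linearity yields transitivity of the order, and a membership-minimal element of a
  subset is its least one. \<open>sat_Ord\<close> carries this out.\<close>

definition ord :: "'a \<Rightarrow> bool" where
  "ord x = ((\<forall>y. y \<epsilon> x \<longrightarrow> sub y x) \<and> (\<forall>y z. y \<epsilon> x \<longrightarrow> z \<epsilon> x \<longrightarrow> y \<epsilon> z \<or> y = z \<or> z \<epsilon> y))"

text \<open>\<open>f\<close> is the function on \<open>a \<union> {a}\<close> given by \<open>f(b) = \<Union>{{z. Q z (f(g))} | g \<in> b}\<close>.\<close>

definition recfun :: "('a \<Rightarrow> 'a \<Rightarrow> bool) \<Rightarrow> 'a \<Rightarrow> 'a \<Rightarrow> bool" where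
  "recfun Q a f \<longleftrightarrow>
    (\<forall>p. p \<epsilon> f \<longrightarrow> (\<exists>b y. opair p b y \<and> (b \<epsilon> a \<or> b = a))) \<and>
    (\<forall>b. b \<epsilon> a \<or> b = a \<longrightarrow> (\<exists>y. \<forall>z. maps f b z \<longleftrightarrow> z = y)) \<and>
    (\<forall>b y. (b \<epsilon> a \<or> b = a) \<and> maps f b y \<longrightarrow>
      (\<forall>z. z \<epsilon> y \<longleftrightarrow> (\<exists>g u. g \<epsilon> b \<and> maps f g u \<and> Q z u)))"

definition isrec :: "('a \<Rightarrow> 'a \<Rightarrow> bool) \<Rightarrow> 'a \<Rightarrow> 'a \<Rightarrow> bool" where
  "isrec Q a v = (\<exists>f. recfun Q a f \<and> maps f a v)"

definition inV :: "'a \<Rightarrow> 'a \<Rightarrow> bool" where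
  "inV x a = (\<exists>v. isrec sub a v \<and> x \<epsilon> v)"

lemma sat_Sub [simp]: "sat e (Sub a b) = sub (e a) (e b)"
  by (simp add: Sub_def sub_def)

lemma sat_IsOPair [simp]: "sat e (IsOPair p a b) = opair (e p) (e a) (e b)"
  by (simp add: IsOPair_def opair_def IsUPair_def)

lemma sat_Maps [simp]: "sat e (Maps f a b) = maps (e f) (e a) (e b)"
  by (simp add: Maps_def maps_def)

lemma sat_IsV [simp]: "sat e (IsV a v) = isrec sub (e a) (e v)"
  by (simp add: IsV_def isrec_def recfun_def)

lemma sat_InV [simp]: "sat e (InV x a) = inV (e x) (e a)"
  by (simp add: InV_def inV_def)

text \<open>
  The graph of the recursion for \<open>Q z u \<longleftrightarrow> q(z, u, e)\<close>: \<open>IsRec q\<close> has the arguments \<open>v\<close>, \<open>a\<close>, \<open>e\<close>,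
  and \<open>IsV\<close> is the case \<open>q = Sub 0 1\<close>.
\<close>
definition IsRec :: "fm \<Rightarrow> fm" where
  "IsRec q = Ex (Conj
    [BAll 0 (Ex (Ex (IsOPair 2 1 0 \<^bold>\<and> (1 \<^bold>\<in> 5 \<^bold>\<or> 1 \<^bold>= 5)))),
     All (0 \<^bold>\<in> 3 \<^bold>\<or> 0 \<^bold>= 3 \<^bold>\<longrightarrow> Ex (All (Maps 3 2 0 \<^bold>\<longleftrightarrow> 0 \<^bold>= 1))),
     All (All ((1 \<^bold>\<in> 4 \<^bold>\<or> 1 \<^bold>= 4) \<^bold>\<and> Maps 2 1 0 \<^bold>\<longrightarrow>
       All (0 \<^bold>\<in> 1 \<^bold>\<longleftrightarrow> Ex (Ex (1 \<^bold>\<in> 4 \<^bold>\<and> Maps 5 1 0 \<^bold>\<and>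
         rename (2 \<cdot> 0 \<cdot> (\<lambda>v. v + 8)) q))))),
     Maps 0 2 1])"

lemma syms_IsRec [simp]: "syms (IsRec q) = syms q"
  by (simp add: IsRec_def)

lemma sat_IsRec:
  assumes "\<And>z u. sat (z \<cdot> u \<cdot> e0) q = Q z u"
  shows "sat (v \<cdot> a \<cdot> e0) (IsRec q) = isrec Q a v"
  using assms by (simp add: IsRec_def isrec_def recfun_def sat_rename_scons)

end

section \<open>Set theory in a model\<close>

text \<open>Separation reaches only \<open>K\<close>, collection also \<open>I\<close>. The
  environment \<open>e\<close> provides all parameters at once, so that arguments inside the model
  need not count them.\<close>

locale zf_model = interpretation_of_symbols E R I for E (infix "\<epsilon>" 50) and R I +
  fixes K :: "sym set"
  assumes ext: "(\<And>z. z \<epsilon> x \<longleftrightarrow> z \<epsilon> y) \<Longrightarrow> x = y"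
    and foundation: "y \<epsilon> x \<Longrightarrow> \<exists>y. y \<epsilon> x \<and> (\<forall>z. z \<epsilon> x \<longrightarrow> \<not> z \<epsilon> y)"
    and pairing: "\<exists>p. \<forall>z. z \<epsilon> p \<longleftrightarrow> z = a \<or> z = b"
    and union: "\<exists>u. \<forall>z. z \<epsilon> u \<longleftrightarrow> (\<exists>y. y \<epsilon> x \<and> z \<epsilon> y)"
    and power: "\<exists>u. \<forall>z. z \<epsilon> u \<longleftrightarrow> sub z x"
    and infinity: "\<exists>w. (\<exists>z. z \<epsilon> w \<and> (\<forall>u. \<not> u \<epsilon> z)) \<and>
      (\<forall>x. x \<epsilon> w \<longrightarrow> (\<exists>s. s \<epsilon> w \<and> (\<forall>z. z \<epsilon> s \<longleftrightarrow> z \<epsilon> x \<or> z = x)))"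
    and sep: "syms p \<subseteq> K \<Longrightarrow> \<exists>w. \<forall>x. x \<epsilon> w \<longleftrightarrow> x \<epsilon> v \<and> sat (x \<cdot> e) p"
    and coll: "syms p \<subseteq> insert ISym K \<Longrightarrow>
      (\<And>x. x \<epsilon> v \<Longrightarrow> \<exists>y. sat (x \<cdot> y \<cdot> e) p) \<Longrightarrow>
      \<exists>w. \<forall>x. x \<epsilon> v \<longrightarrow> (\<exists>y. y \<epsilon> w \<and> sat (x \<cdot> y \<cdot> e) p)"
begin

text \<open>Limited to \<open>K\<close>, since the set delivered by collection is trimmed by
  separation.\<close>

lemma replacement:
  assumes "syms p \<subseteq> K" and ex: "\<And>x. x \<epsilon> v \<Longrightarrow> \<exists>y. sat (x \<cdot> y \<cdot> e) p"
    and uniq: "\<And>x y y'. x \<epsilon> v \<Longrightarrow> sat (x \<cdot> y \<cdot> e) p \<Longrightarrow>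
      sat (x \<cdot> y' \<cdot> e) p \<Longrightarrow> y = y'"
  shows "\<exists>w. \<forall>y. y \<epsilon> w \<longleftrightarrow> (\<exists>x. x \<epsilon> v \<and> sat (x \<cdot> y \<cdot> e) p)"
proof -
  have "\<exists>w. \<forall>x. x \<epsilon> v \<longrightarrow> (\<exists>y. y \<epsilon> w \<and> sat (x \<cdot> y \<cdot> e) p)"
    by (rule coll) (use assms in auto)
  then obtain w where w: "\<forall>x. x \<epsilon> v \<longrightarrow> (\<exists>y. y \<epsilon> w \<and> sat (x \<cdot> y \<cdot> e) p)" by blast
  let ?p = "BEx 1 (rename (0 \<cdot> 1 \<cdot> (\<lambda>v. v + 3)) p)"
  have "sat (y \<cdot> v \<cdot> e) ?p \<longleftrightarrow> (\<exists>x. x \<epsilon> v \<and> sat (x \<cdot> y \<cdot> e) p)" for y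
    by (simp add: sat_rename_scons)
  moreover have "\<exists>w'. \<forall>y. y \<epsilon> w' \<longleftrightarrow> y \<epsilon> w \<and> sat (y \<cdot> v \<cdot> e) ?p"
    by (rule sep) (use assms(1) in simp)
  ultimately show ?thesis using w uniq by metis
qed

text \<open>Collection demands a witness for every \<open>x\<close>. The implication from the
  existence of a witness to \<open>p\<close> always has one, and it is equivalent to
  \<open>p\<close> wherever \<open>p\<close> has a witness.\<close>

lemma coll_partial:
  assumes "syms p \<subseteq> insert ISym K"
  shows "\<exists>w. \<forall>x. x \<epsilon> v \<longrightarrow> (\<exists>y. sat (x \<cdot> y \<cdot> e) p) \<longrightarrow>
    (\<exists>y. y \<epsilon> w \<and> sat (x \<cdot> y \<cdot> e) p)"
proof -
  let ?p = "Ex (rename (1 \<cdot> 0 \<cdot> (\<lambda>v. v + 3)) p) \<^bold>\<longrightarrow> p"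
  have p: "sat (x \<cdot> y \<cdot> e) ?p \<longleftrightarrow>
    ((\<exists>y. sat (x \<cdot> y \<cdot> e) p) \<longrightarrow> sat (x \<cdot> y \<cdot> e) p)" for x y
    by (simp add: sat_rename_scons)
  have "\<exists>w. \<forall>x. x \<epsilon> v \<longrightarrow> (\<exists>y. y \<epsilon> w \<and> sat (x \<cdot> y \<cdot> e) ?p)"
  proof (rule coll)
    show "\<exists>y. sat (x \<cdot> y \<cdot> e) ?p" for x unfolding p by blast
  qed (use assms in simp)
  then show ?thesis unfolding p by blast
qed

subsection \<open>Pairs and ordinals\<close>

lemma insert_set: "\<exists>s. \<forall>z. z \<epsilon> s \<longleftrightarrow> z \<epsilon> x \<or> z = y"
proof -
  obtain p where p: "\<And>z. z \<epsilon> p \<longleftrightarrow> z = y" using pairing[of y y] by auto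
  obtain d where d: "\<And>z. z \<epsilon> d \<longleftrightarrow> z = x \<or> z = p" using pairing by metis
  obtain u where "\<And>z. z \<epsilon> u \<longleftrightarrow> (\<exists>y. y \<epsilon> d \<and> z \<epsilon> y)" using union by metis
  then show ?thesis using p d by metis
qed

lemma binary_union: "\<exists>s. \<forall>z. z \<epsilon> s \<longleftrightarrow> z \<epsilon> x \<or> z \<epsilon> y"
proof -
  obtain d where d: "\<And>z. z \<epsilon> d \<longleftrightarrow> z = x \<or> z = y" using pairing by metis
  obtain u where "\<And>z. z \<epsilon> u \<longleftrightarrow> (\<exists>y. y \<epsilon> d \<and> z \<epsilon> y)" using union by metis
  then show ?thesis using d by metis
qed

lemma no_three_cycle: "\<not> (x \<epsilon> y \<and> y \<epsilon> z \<and> z \<epsilon> x)"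
proof
  assume a: "x \<epsilon> y \<and> y \<epsilon> z \<and> z \<epsilon> x"
  obtain p where p: "\<And>u. u \<epsilon> p \<longleftrightarrow> u = x \<or> u = y" using pairing by metis
  obtain s where s: "\<And>u. u \<epsilon> s \<longleftrightarrow> u \<epsilon> p \<or> u = z" using insert_set by metis
  show False using foundation[of x s] a s p by metis
qed

lemma no_two_cycle: "\<not> (x \<epsilon> y \<and> y \<epsilon> x)"
proof
  assume a: "x \<epsilon> y \<and> y \<epsilon> x"
  obtain p where p: "\<And>u. u \<epsilon> p \<longleftrightarrow> u = x \<or> u = y" using pairing by metis
  show False using foundation[of x p] a p by metis
qed

lemma not_mem_self: "\<not> x \<epsilon> x"
  using no_two_cycle by blast

lemma opair_exists: "\<exists>p. opair p a b"
proof -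
  obtain s where s: "\<And>z. z \<epsilon> s \<longleftrightarrow> z = a" using pairing[of a a] by auto
  obtain d where d: "\<And>z. z \<epsilon> d \<longleftrightarrow> z = a \<or> z = b" using pairing by metis
  obtain p where p: "\<And>z. z \<epsilon> p \<longleftrightarrow> z = s \<or> z = d" using pairing by metis
  show ?thesis unfolding opair_def by (intro exI[of _ p] exI[of _ s] exI[of _ d]) (simp add: s d p)
qed

lemma opair_unique: "opair p a b \<Longrightarrow> opair q a b \<Longrightarrow> p = q"
proof -
  assume "opair p a b" "opair q a b"
  then obtain s d s' d' where
    "\<forall>z. z \<epsilon> s \<longleftrightarrow> z = a" "\<forall>z. z \<epsilon> d \<longleftrightarrow> z = a \<or> z = b" and p: "\<forall>z. z \<epsilon> p \<longleftrightarrow> z = s \<or> z = d"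
    and "\<forall>z. z \<epsilon> s' \<longleftrightarrow> z = a" "\<forall>z. z \<epsilon> d' \<longleftrightarrow> z = a \<or> z = b" and q: "\<forall>z. z \<epsilon> q \<longleftrightarrow> z = s' \<or> z = d'"
    unfolding opair_def by blast
  then have "s = s'" "d = d'" by (auto intro!: ext)
  then show "p = q" using p q by (auto intro!: ext)
qed

lemma opair_inject: "opair p a b \<Longrightarrow> opair p a' b' \<Longrightarrow> a = a' \<and> b = b'"
proof -
  assume "opair p a b" "opair p a' b'"
  then obtain s d s' d' where
    "\<forall>z. z \<epsilon> s \<longleftrightarrow> z = a" "\<forall>z. z \<epsilon> d \<longleftrightarrow> z = a \<or> z = b" "\<forall>z. z \<epsilon> p \<longleftrightarrow> z = s \<or> z = d"
    "\<forall>z. z \<epsilon> s' \<longleftrightarrow> z = a'" "\<forall>z. z \<epsilon> d' \<longleftrightarrow> z = a' \<or> z = b'" "\<forall>z. z \<epsilon> p \<longleftrightarrow> z = s' \<or> z = d'"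
    unfolding opair_def by blast
  then show "a = a' \<and> b = b'" by metis
qed

lemma sat_Ord [simp]: "sat e (Ord v) = ord (e v)"
proof -
  let ?x = "e v"
  have iff: "sat e (Ord v) \<longleftrightarrow> (\<forall>y. y \<epsilon> ?x \<longrightarrow> sub y ?x) \<and> (\<forall>y. y \<epsilon> ?x \<longrightarrow> \<not> y \<epsilon> y) \<and>
    (\<forall>a. a \<epsilon> ?x \<longrightarrow> (\<forall>b. b \<epsilon> ?x \<longrightarrow> (\<forall>c. c \<epsilon> ?x \<longrightarrow> a \<epsilon> b \<and> b \<epsilon> c \<longrightarrow> a \<epsilon> c))) \<and>
    (\<forall>y. y \<epsilon> ?x \<longrightarrow> (\<forall>z. z \<epsilon> ?x \<longrightarrow> y \<epsilon> z \<or> y = z \<or> z \<epsilon> y)) \<and>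
    (\<forall>s. sub s ?x \<and> (\<exists>y. y \<epsilon> s) \<longrightarrow> (\<exists>m. m \<epsilon> s \<and> (\<forall>z. z \<epsilon> s \<longrightarrow> m \<epsilon> z \<or> m = z)))"
    by (simp add: Ord_def Nonempty_def)
  show ?thesis
  proof
    assume "sat e (Ord v)"
    then show "ord (e v)" unfolding iff ord_def by blast
  next
    assume o: "ord (e v)"
    have trans: "a \<epsilon> c" if "a \<epsilon> ?x" "b \<epsilon> ?x" "c \<epsilon> ?x" "a \<epsilon> b" "b \<epsilon> c" for a b c
    proof -
      have "a \<epsilon> c \<or> a = c \<or> c \<epsilon> a" using o that(1,3) unfolding ord_def by blast
      then show ?thesis using that(4,5) no_two_cycle[of a b] no_three_cycle[of a b c] by blast
    qed
    have least: "\<exists>m. m \<epsilon> s \<and> (\<forall>z. z \<epsilon> s \<longrightarrow> m \<epsilon> z \<or> m = z)" if "sub s ?x" "y \<epsilon> s" for s y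
    proof -
      obtain m where m: "m \<epsilon> s" "\<forall>z. z \<epsilon> s \<longrightarrow> \<not> z \<epsilon> m" using foundation[OF \<open>y \<epsilon> s\<close>] by blast
      have "m \<epsilon> z \<or> m = z \<or> z \<epsilon> m" if "z \<epsilon> s" for z
        using o \<open>sub s ?x\<close> that m(1) unfolding ord_def sub_def by blast
      then show ?thesis using m by blast
    qed
    show "sat e (Ord v)"
      unfolding iff
    proof (intro conjI)
      show "\<forall>s. sub s ?x \<and> (\<exists>y. y \<epsilon> s) \<longrightarrow> (\<exists>m. m \<epsilon> s \<and> (\<forall>z. z \<epsilon> s \<longrightarrow> m \<epsilon> z \<or> m = z))"
        using least by blast
    qed (use o not_mem_self trans in \<open>unfold ord_def, blast+\<close>)
  qed
qed

lemma ord_trans: "ord c \<Longrightarrow> a \<epsilon> b \<Longrightarrow> b \<epsilon> c \<Longrightarrow> a \<epsilon> c"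
  unfolding ord_def sub_def by blast

lemma ord_mem: assumes "ord a" "b \<epsilon> a" shows "ord b"
  unfolding ord_def sub_def
proof (intro conjI allI impI)
  fix y z assume "y \<epsilon> b" "z \<epsilon> y"
  then have "y \<epsilon> a" "z \<epsilon> a" using assms ord_trans by blast+
  then show "z \<epsilon> b" using assms \<open>y \<epsilon> b\<close> \<open>z \<epsilon> y\<close> no_two_cycle[of z y] no_three_cycle[of b z y]
    unfolding ord_def by blast
next
  fix y z assume "y \<epsilon> b" "z \<epsilon> b"
  then have "y \<epsilon> a" "z \<epsilon> a" using assms ord_trans by blast+
  then show "y \<epsilon> z \<or> y = z \<or> z \<epsilon> y" using assms unfolding ord_def by blast
qed

text \<open>The counterexamples among \<open>a\<close> and its elements form a set by separation,
  hence the restriction to \<open>K\<close>; Foundation provides a minimal one.\<close>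

lemma ord_induct:
  assumes "syms p \<subseteq> K" "ord a"
    and step: "\<And>a. ord a \<Longrightarrow> (\<And>b. b \<epsilon> a \<Longrightarrow> sat (b \<cdot> e) p) \<Longrightarrow> sat (a \<cdot> e) p"
  shows "sat (a \<cdot> e) p"
proof (rule ccontr)
  assume neg: "\<not> sat (a \<cdot> e) p"
  obtain s where s: "\<And>z. z \<epsilon> s \<longleftrightarrow> z \<epsilon> a \<or> z = a" using insert_set by metis
  have "\<exists>w. \<forall>x. x \<epsilon> w \<longleftrightarrow> x \<epsilon> s \<and> sat (x \<cdot> e) (Neg p)" by (rule sep) (use assms(1) in simp)
  then obtain w where w: "\<And>x. x \<epsilon> w \<longleftrightarrow> x \<epsilon> s \<and> \<not> sat (x \<cdot> e) p" by auto
  then have "a \<epsilon> w" using s neg by blast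
  then obtain m where m: "m \<epsilon> w" "\<And>z. z \<epsilon> w \<Longrightarrow> \<not> z \<epsilon> m" using foundation by blast
  then have ms: "m \<epsilon> s" using w by blast
  then have "ord m" using s[of m] ord_mem[OF \<open>ord a\<close>, of m] \<open>ord a\<close> by blast
  moreover have "sat (b \<cdot> e) p" if "b \<epsilon> m" for b
  proof -
    have "b \<epsilon> s" using ms that s[of m] s[of b] ord_trans[OF \<open>ord a\<close> that] by blast
    moreover have "\<not> b \<epsilon> w" using m(2) that by blast
    ultimately show ?thesis using w[of b] by blast
  qed
  ultimately have "sat (m \<cdot> e) p" by (rule step)
  then show False using m(1) w[of m] by blast
qed

text \<open>Double induction. If neither of \<open>a\<close> and \<open>b\<close> belongs to the
  other, the two hypotheses put every element of \<open>a\<close> into \<open>b\<close> and every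
  element of \<open>b\<close> into \<open>a\<close>, so extensionality gives equality.\<close>

lemma ord_linear: assumes "ord a" "ord b" shows "a \<epsilon> b \<or> a = b \<or> b \<epsilon> a"
proof -
  let ?p = "All (Ord 0 \<^bold>\<longrightarrow> 1 \<^bold>\<in> 0 \<^bold>\<or> 1 \<^bold>= 0 \<^bold>\<or> 0 \<^bold>\<in> 1)"
  let ?q = "1 \<^bold>\<in> 0 \<^bold>\<or> 1 \<^bold>= 0 \<^bold>\<or> 0 \<^bold>\<in> 1"
  have "sat (a \<cdot> (\<lambda>_. undefined)) ?p"
  proof (rule ord_induct)
    fix a assume a: "ord a" and IH: "\<And>b. b \<epsilon> a \<Longrightarrow> sat (b \<cdot> (\<lambda>_. undefined)) ?p"
    have IH: "c \<epsilon> b \<or> c = b \<or> b \<epsilon> c" if "c \<epsilon> a" "ord b" for b c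
      using IH[OF that(1)] that(2) by simp
    have "sat (b \<cdot> a \<cdot> (\<lambda>_. undefined)) ?q" if "ord b" for b
    proof (rule ord_induct)
      fix b assume b: "ord b" and IH2: "\<And>c. c \<epsilon> b \<Longrightarrow> sat (c \<cdot> a \<cdot> (\<lambda>_. undefined)) ?q"
      have IH2: "a \<epsilon> c \<or> a = c \<or> c \<epsilon> a" if "c \<epsilon> b" for c using IH2[OF that] by simp
      have "a = b" if "\<not> a \<epsilon> b" "\<not> b \<epsilon> a"
      proof (rule ext)
        fix z show "z \<epsilon> a \<longleftrightarrow> z \<epsilon> b"
          using IH[of z b] IH2[of z] that a b ord_trans[of a] ord_trans[of b] by blast
      qed
      then show "sat (b \<cdot> a \<cdot> (\<lambda>_. undefined)) ?q" by auto
    qed (use that in simp_all)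
    then show "sat (a \<cdot> (\<lambda>_. undefined)) ?p" by simp
  qed (use assms in simp_all)
  then show ?thesis using assms by simp
qed

lemma ord_union:
  assumes "\<And>x. x \<epsilon> s \<Longrightarrow> ord x" "\<And>z. z \<epsilon> u \<longleftrightarrow> (\<exists>y. y \<epsilon> s \<and> z \<epsilon> y)"
  shows "ord u"
  unfolding ord_def sub_def
proof (intro conjI allI impI)
  fix y z assume "y \<epsilon> u" "z \<epsilon> y"
  then show "z \<epsilon> u" using assms ord_trans by blast
next
  fix y z assume "y \<epsilon> u" "z \<epsilon> u"
  then have "ord y" "ord z" using assms ord_mem by blast+
  then show "y \<epsilon> z \<or> y = z \<or> z \<epsilon> y" by (rule ord_linear)
qed

lemma ord_succ:
  assumes "ord a" shows "\<exists>s. ord s \<and> (\<forall>z. z \<epsilon> s \<longleftrightarrow> z \<epsilon> a \<or> z = a)"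
proof -
  obtain s where s: "\<And>z. z \<epsilon> s \<longleftrightarrow> z \<epsilon> a \<or> z = a" using insert_set by metis
  have "ord s" using assms unfolding ord_def sub_def s by blast
  then show ?thesis using s by blast
qed

text \<open>The union \<open>c\<close> of the ordinals in \<open>u\<close> is an ordinal that
  belongs to none of them, so by linearity each is at most \<open>c\<close>, and the successor of
  \<open>c\<close> is a strict bound.\<close>

lemma ord_bound: "\<exists>b. ord b \<and> (\<forall>a. a \<epsilon> u \<longrightarrow> ord a \<longrightarrow> a \<epsilon> b)"
proof -
  have "\<exists>w. \<forall>x. x \<epsilon> w \<longleftrightarrow> x \<epsilon> u \<and> sat (x \<cdot> (\<lambda>_. undefined)) (Ord 0)" by (rule sep) simp
  then obtain w where w: "\<And>x. x \<epsilon> w \<longleftrightarrow> x \<epsilon> u \<and> ord x" by auto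
  obtain c where c: "\<And>z. z \<epsilon> c \<longleftrightarrow> (\<exists>y. y \<epsilon> w \<and> z \<epsilon> y)" using union by metis
  have "ord c" using ord_union[of w c] w c by blast
  then obtain b where b: "ord b" "\<And>z. z \<epsilon> b \<longleftrightarrow> z \<epsilon> c \<or> z = c" using ord_succ by metis
  have "a \<epsilon> b" if "a \<epsilon> u" "ord a" for a
    using ord_linear[OF that(2) \<open>ord c\<close>] that w c b not_mem_self by blast
  then show ?thesis using b by blast
qed

text \<open>Stands in for omega as a length of recursions. The ordinals in an inductive set include
  the empty set and are closed under successor, so their union has no greatest element.\<close>

lemma limit_ordinal: "\<exists>l. ord l \<and> (\<exists>z. z \<epsilon> l) \<and> (\<forall>a. a \<epsilon> l \<longrightarrow> (\<exists>b. b \<epsilon> l \<and> a \<epsilon> b))"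
proof -
  obtain x z where z: "z \<epsilon> x" "\<And>u. \<not> u \<epsilon> z"
    and x: "\<And>y. y \<epsilon> x \<Longrightarrow> \<exists>s. s \<epsilon> x \<and> (\<forall>z. z \<epsilon> s \<longleftrightarrow> z \<epsilon> y \<or> z = y)"
    using exE[OF infinity] by metis
  have "\<exists>w. \<forall>y. y \<epsilon> w \<longleftrightarrow> y \<epsilon> x \<and> sat (y \<cdot> (\<lambda>_. undefined)) (Ord 0)" by (rule sep) simp
  then obtain w where w: "\<And>y. y \<epsilon> w \<longleftrightarrow> y \<epsilon> x \<and> ord y" by auto
  obtain l where l: "\<And>z. z \<epsilon> l \<longleftrightarrow> (\<exists>y. y \<epsilon> w \<and> z \<epsilon> y)" using union by metis
  have "ord l" using ord_union[of w l] w l by blast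
  have "z \<epsilon> w" using z w unfolding ord_def sub_def by blast
  have succ: "\<exists>s. s \<epsilon> w \<and> (\<forall>z. z \<epsilon> s \<longleftrightarrow> z \<epsilon> y \<or> z = y)" if y: "y \<epsilon> w" for y
  proof -
    have "y \<epsilon> x" "ord y" using y w by blast+
    obtain s where s: "s \<epsilon> x" "\<And>z. z \<epsilon> s \<longleftrightarrow> z \<epsilon> y \<or> z = y" using x[OF \<open>y \<epsilon> x\<close>] by blast
    obtain s' where s': "ord s'" "\<And>z. z \<epsilon> s' \<longleftrightarrow> z \<epsilon> y \<or> z = y" using ord_succ[OF \<open>ord y\<close>] by blast
    have "s = s'" by (rule ext) (simp add: s s')
    then show ?thesis using s s' w by blast
  qed
  have "\<exists>z. z \<epsilon> l" using succ[OF \<open>z \<epsilon> w\<close>] l by blast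
  moreover have "\<exists>b. b \<epsilon> l \<and> a \<epsilon> b" if a: "a \<epsilon> l" for a
  proof -
    obtain y where y: "y \<epsilon> w" "a \<epsilon> y" using a l by blast
    then show ?thesis using succ[OF y(1)] l by blast
  qed
  ultimately show ?thesis using \<open>ord l\<close> by blast
qed

end

subsection \<open>Recursion on ordinals\<close>

text \<open>Instantiated twice: \<open>Q = sub\<close> gives the levels of the hierarchy, and
  \<open>transitive_superset\<close> uses a relation that adds elements of elements. The formula
  \<open>q\<close> expresses \<open>Q\<close> in the language, so that induction and replacement
  apply to the recursion.\<close>

locale recursion = zf_model +
  fixes Q :: "'a \<Rightarrow> 'a \<Rightarrow> bool" and q :: fm and e0 :: "nat \<Rightarrow> 'a"
  assumes syms_q: "syms q \<subseteq> K" and sat_q: "sat (z \<cdot> u \<cdot> e0) q = Q z u"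
    and set_like: "\<exists>w. \<forall>z. z \<epsilon> w \<longleftrightarrow> Q z u"
begin

lemma recfun_ex1: "recfun Q a f \<Longrightarrow> b \<epsilon> a \<or> b = a \<Longrightarrow> \<exists>y. \<forall>z. maps f b z \<longleftrightarrow> z = y"
  unfolding recfun_def by blast

lemma recfun_mem:
  "recfun Q a f \<Longrightarrow> b \<epsilon> a \<or> b = a \<Longrightarrow> maps f b y \<Longrightarrow>
    z \<epsilon> y \<longleftrightarrow> (\<exists>g u. g \<epsilon> b \<and> maps f g u \<and> Q z u)"
  unfolding recfun_def by blast

lemma recfun_agree:
  assumes "ord a" "ord a'" and f: "recfun Q a f" "recfun Q a' f'"
    and b: "b \<epsilon> a \<or> b = a" "b \<epsilon> a' \<or> b = a'" and y: "maps f b y" "maps f' b y'"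
  shows "y = y'"
proof -
  let ?e = "a \<cdot> a' \<cdot> f \<cdot> f' \<cdot> (\<lambda>_. undefined)"
  let ?p = "(0 \<^bold>\<in> 1 \<^bold>\<or> 0 \<^bold>= 1) \<^bold>\<and> (0 \<^bold>\<in> 2 \<^bold>\<or> 0 \<^bold>= 2) \<^bold>\<longrightarrow> All (All (Maps 5 2 1 \<^bold>\<and> Maps 6 2 0 \<^bold>\<longrightarrow> 1 \<^bold>= 0))"
  have p: "sat (b \<cdot> ?e) ?p \<longleftrightarrow> ((b \<epsilon> a \<or> b = a) \<and> (b \<epsilon> a' \<or> b = a') \<longrightarrow>
      (\<forall>y y'. maps f b y \<and> maps f' b y' \<longrightarrow> y = y'))" for b
    by simp
  have "ord b" using b(1) assms(1) ord_mem[of a b] by blast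
  have "sat (b \<cdot> ?e) ?p"
  proof (rule ord_induct[OF _ \<open>ord b\<close>])
    fix b assume IH: "\<And>g. g \<epsilon> b \<Longrightarrow> sat (g \<cdot> ?e) ?p"
    have "y = y'" if ba: "b \<epsilon> a \<or> b = a" and ba': "b \<epsilon> a' \<or> b = a'"
      and y: "maps f b y" "maps f' b y'" for y y'
    proof (rule ext)
      fix z
      have "maps f g u \<longleftrightarrow> maps f' g u" if "g \<epsilon> b" for g u
      proof -
        have g: "g \<epsilon> a \<or> g = a" "g \<epsilon> a' \<or> g = a'"
          using that ba ba' ord_trans[OF \<open>ord a\<close> that] ord_trans[OF \<open>ord a'\<close> that] by blast+
        obtain v where v: "\<forall>z. maps f g z \<longleftrightarrow> z = v" using recfun_ex1[OF f(1) g(1)] by blast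
        obtain v' where v': "\<forall>z. maps f' g z \<longleftrightarrow> z = v'" using recfun_ex1[OF f(2) g(2)] by blast
        have "v = v'" using IH[OF that, unfolded p] g v v' by blast
        then show ?thesis using v v' by simp
      qed
      then show "z \<epsilon> y \<longleftrightarrow> z \<epsilon> y'"
        using recfun_mem[OF f(1) ba y(1), of z] recfun_mem[OF f(2) ba' y(2), of z] by blast
    qed
    then show "sat (b \<cdot> ?e) ?p" unfolding p by blast
  qed simp
  then show ?thesis unfolding p using b y by blast
qed

lemma isrec_unique: "ord a \<Longrightarrow> isrec Q a v \<Longrightarrow> isrec Q a v' \<Longrightarrow> v = v'"
  unfolding isrec_def using recfun_agree[of a a _ _ a v v'] by blast

text \<open>Makes the value at \<open>g\<close> independent of the ordinal up to which the recursion
  has been carried out.\<close>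

lemma recfun_restrict:
  assumes "ord a" and f: "recfun Q a f" and g: "g \<epsilon> a"
  shows "\<exists>h. recfun Q g h \<and> (\<forall>b y. maps h b y \<longleftrightarrow> (b \<epsilon> g \<or> b = g) \<and> maps f b y)"
proof -
  let ?p = "Ex (Ex (IsOPair 2 1 0 \<^bold>\<and> (1 \<^bold>\<in> 3 \<^bold>\<or> 1 \<^bold>= 3)))"
  have "\<exists>h. \<forall>p. p \<epsilon> h \<longleftrightarrow> p \<epsilon> f \<and> sat (p \<cdot> g \<cdot> (\<lambda>_. undefined)) ?p"
    by (rule sep) simp
  then obtain h where h: "\<And>p. p \<epsilon> h \<longleftrightarrow> p \<epsilon> f \<and> (\<exists>b y. opair p b y \<and> (b \<epsilon> g \<or> b = g))" by auto
  have maps_h: "maps h b y \<longleftrightarrow> (b \<epsilon> g \<or> b = g) \<and> maps f b y" for b y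
    unfolding maps_def h using opair_inject by blast
  have mem: "b \<epsilon> a" if "b \<epsilon> g \<or> b = g" for b
    using that g ord_trans[OF \<open>ord a\<close> _ g, of b] by blast
  have "recfun Q g h"
    unfolding recfun_def
  proof (intro conjI allI impI)
    fix p assume "p \<epsilon> h"
    then show "\<exists>b y. opair p b y \<and> (b \<epsilon> g \<or> b = g)" using h by blast
  next
    fix b assume b: "b \<epsilon> g \<or> b = g"
    then show "\<exists>y. \<forall>z. maps h b z \<longleftrightarrow> z = y"
      using recfun_ex1[OF f, of b] mem[OF b] by (simp add: maps_h)
  next
    fix b y z assume bmap: "(b \<epsilon> g \<or> b = g) \<and> maps h b y"
    then have "b \<epsilon> a" "maps f b y" using mem maps_h by blast+
    then have "z \<epsilon> y \<longleftrightarrow> (\<exists>c u. c \<epsilon> b \<and> maps f c u \<and> Q z u)" using recfun_mem[OF f] by blast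
    moreover have "c \<epsilon> g \<or> c = g" if "c \<epsilon> b" for c
      using bmap that ord_trans[OF ord_mem[OF \<open>ord a\<close> g] that] by blast
    ultimately show "z \<epsilon> y \<longleftrightarrow> (\<exists>c u. c \<epsilon> b \<and> maps h c u \<and> Q z u)" unfolding maps_h by blast
  qed
  then show ?thesis using maps_h by blast
qed

lemma maps_iff_isrec:
  assumes "ord a" "recfun Q a f" "g \<epsilon> a"
  shows "maps f g u \<longleftrightarrow> isrec Q g u"
proof -
  obtain h where h: "recfun Q g h" "\<forall>b y. maps h b y \<longleftrightarrow> (b \<epsilon> g \<or> b = g) \<and> maps f b y"
    using recfun_restrict[OF assms] by blast
  obtain v where v: "\<forall>z. maps f g z \<longleftrightarrow> z = v" using recfun_ex1[OF assms(2)] assms(3) by blast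
  have "isrec Q g v" unfolding isrec_def using h v by blast
  then show ?thesis using v isrec_unique[OF ord_mem[OF assms(1,3)], of v u] by auto
qed

lemma isrec_mem:
  assumes "ord a" "isrec Q a v"
  shows "z \<epsilon> v \<longleftrightarrow> (\<exists>g u. g \<epsilon> a \<and> isrec Q g u \<and> Q z u)"
proof -
  obtain f where f: "recfun Q a f" "maps f a v" using assms(2) unfolding isrec_def by blast
  then show ?thesis
    using recfun_mem[OF f(1) _ f(2), of z] maps_iff_isrec[OF assms(1) f(1)] by blast
qed

lemma isrec_exists: assumes "ord a" shows "\<exists>v. isrec Q a v"
proof -
  have rec: "sat (v \<cdot> a \<cdot> e0) (IsRec q) = isrec Q a v" for a v by (rule sat_IsRec) (rule sat_q)
  have "sat (a \<cdot> e0) (Ex (IsRec q))"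
  proof (rule ord_induct[OF _ assms])
    fix a assume a: "ord a" and IH: "\<And>b. b \<epsilon> a \<Longrightarrow> sat (b \<cdot> e0) (Ex (IsRec q))"
    have ex: "\<exists>v. isrec Q b v" if "b \<epsilon> a" for b using IH[OF that] by (simp add: rec)
    have uniq: "v = v'" if "b \<epsilon> a" "isrec Q b v" "isrec Q b v'" for b v v'
      using isrec_unique[OF ord_mem[OF a]] that by blast
    \<comment> \<open>\<open>F\<close> will be the graph of the recursion below \<open>a\<close>,
      with one pair for each \<open>b\<close> in \<open>a\<close>.\<close>
    let ?p = "Ex (rename (0 \<cdot> 1 \<cdot> (\<lambda>v. v + 3)) (IsRec q) \<^bold>\<and> IsOPair 2 1 0)"
    have p: "sat (b \<cdot> p \<cdot> e0) ?p \<longleftrightarrow> (\<exists>v. isrec Q b v \<and> opair p b v)" for b p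
      by (simp add: sat_rename_scons rec)
    have "\<exists>w. \<forall>p. p \<epsilon> w \<longleftrightarrow> (\<exists>b. b \<epsilon> a \<and> sat (b \<cdot> p \<cdot> e0) ?p)"
    proof (rule replacement)
      show "\<exists>p. sat (b \<cdot> p \<cdot> e0) ?p" if "b \<epsilon> a" for b
        unfolding p using ex[OF that] opair_exists by blast
      show "p = p'" if "b \<epsilon> a" "sat (b \<cdot> p \<cdot> e0) ?p" "sat (b \<cdot> p' \<cdot> e0) ?p" for b p p'
        using that(2,3) uniq[OF that(1)] opair_unique unfolding p by blast
    qed (use syms_q in simp)
    then obtain F where F: "\<And>p. p \<epsilon> F \<longleftrightarrow> (\<exists>b. b \<epsilon> a \<and> (\<exists>v. isrec Q b v \<and> opair p b v))"
      unfolding p by blast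
    \<comment> \<open>\<open>w\<close> collects the sets \<open>{z. Q z v}\<close> for the values
      \<open>v\<close> at elements of \<open>a\<close>; their union \<open>v0\<close> is the value
      required at \<open>a\<close> itself.\<close>
    let ?r = "Ex (rename (0 \<cdot> 1 \<cdot> (\<lambda>v. v + 3)) (IsRec q) \<^bold>\<and>
      All (0 \<^bold>\<in> 3 \<^bold>\<longleftrightarrow> rename (0 \<cdot> 1 \<cdot> (\<lambda>v. v + 4)) q))"
    have r: "sat (b \<cdot> y \<cdot> e0) ?r \<longleftrightarrow> (\<exists>v. isrec Q b v \<and> (\<forall>z. z \<epsilon> y \<longleftrightarrow> Q z v))" for b y
      by (simp add: sat_rename_scons rec sat_q)
    have "\<exists>w. \<forall>y. y \<epsilon> w \<longleftrightarrow> (\<exists>b. b \<epsilon> a \<and> sat (b \<cdot> y \<cdot> e0) ?r)"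
    proof (rule replacement)
      show "\<exists>y. sat (b \<cdot> y \<cdot> e0) ?r" if "b \<epsilon> a" for b
        unfolding r using ex[OF that] set_like by blast
      show "y = y'" if "b \<epsilon> a" "sat (b \<cdot> y \<cdot> e0) ?r" "sat (b \<cdot> y' \<cdot> e0) ?r" for b y y'
      proof (rule ext)
        show "z \<epsilon> y \<longleftrightarrow> z \<epsilon> y'" for z using that(2,3) uniq[OF that(1)] unfolding r by blast
      qed
    qed (use syms_q in simp)
    then obtain w where w: "\<And>y. y \<epsilon> w \<longleftrightarrow> (\<exists>b. b \<epsilon> a \<and> (\<exists>v. isrec Q b v \<and> (\<forall>z. z \<epsilon> y \<longleftrightarrow> Q z v)))"
      unfolding r by blast
    obtain v0 where v0: "\<And>z. z \<epsilon> v0 \<longleftrightarrow> (\<exists>y. y \<epsilon> w \<and> z \<epsilon> y)" using union by metis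
    have mem_v0: "z \<epsilon> v0 \<longleftrightarrow> (\<exists>g u. g \<epsilon> a \<and> isrec Q g u \<and> Q z u)" for z
    proof
      assume "z \<epsilon> v0"
      then show "\<exists>g u. g \<epsilon> a \<and> isrec Q g u \<and> Q z u" unfolding v0 w by blast
    next
      assume "\<exists>g u. g \<epsilon> a \<and> isrec Q g u \<and> Q z u"
      then obtain g u where g: "g \<epsilon> a" "isrec Q g u" "Q z u" by blast
      obtain y where "\<forall>z. z \<epsilon> y \<longleftrightarrow> Q z u" using set_like by blast
      then show "z \<epsilon> v0" unfolding v0 w using g by blast
    qed
    obtain t where t: "opair t a v0" using opair_exists by blast
    obtain f where f: "\<And>p. p \<epsilon> f \<longleftrightarrow> p \<epsilon> F \<or> p = t" using insert_set by metis
    have maps_f: "maps f b y \<longleftrightarrow> (b \<epsilon> a \<and> isrec Q b y) \<or> (b = a \<and> y = v0)" for b y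
    proof
      assume "maps f b y"
      then obtain p where p: "p \<epsilon> f" "opair p b y" unfolding maps_def by blast
      then show "(b \<epsilon> a \<and> isrec Q b y) \<or> (b = a \<and> y = v0)"
        using f[of p] F[of p] t opair_inject[OF p(2)] by blast
    next
      assume "(b \<epsilon> a \<and> isrec Q b y) \<or> (b = a \<and> y = v0)"
      then show "maps f b y"
      proof
        assume b: "b \<epsilon> a \<and> isrec Q b y"
        obtain p where "opair p b y" using opair_exists by blast
        then show ?thesis unfolding maps_def f F using b by blast
      next
        assume "b = a \<and> y = v0"
        then show ?thesis unfolding maps_def f using t by blast
      qed
    qed
    have "recfun Q a f"
      unfolding recfun_def
    proof (intro conjI allI impI)
      fix p assume "p \<epsilon> f"
      then show "\<exists>b y. opair p b y \<and> (b \<epsilon> a \<or> b = a)" unfolding f F using t by blast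
    next
      fix b assume b: "b \<epsilon> a \<or> b = a"
      then show "\<exists>y. \<forall>z. maps f b z \<longleftrightarrow> z = y"
        unfolding maps_f using ex[of b] uniq[of b] not_mem_self[of a] by metis
    next
      fix b y z assume bmap: "(b \<epsilon> a \<or> b = a) \<and> maps f b y"
      have sub: "g \<epsilon> a" if "g \<epsilon> b" for g using bmap that ord_trans[OF a that] by blast
      have "z \<epsilon> y \<longleftrightarrow> (\<exists>g u. g \<epsilon> b \<and> isrec Q g u \<and> Q z u)"
      proof (cases "b = a")
        case True
        then have "y = v0" using bmap maps_f not_mem_self by blast
        then show ?thesis using True mem_v0 by simp
      next
        case False
        then have "b \<epsilon> a" "isrec Q b y" using bmap maps_f by blast+
        then show ?thesis using isrec_mem[OF ord_mem[OF a]] by blast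
      qed
      then show "z \<epsilon> y \<longleftrightarrow> (\<exists>g u. g \<epsilon> b \<and> maps f g u \<and> Q z u)"
        unfolding maps_f using sub not_mem_self by blast
    qed
    moreover have "maps f a v0" unfolding maps_f by blast
    ultimately show "sat (a \<cdot> e0) (Ex (IsRec q))" by (auto simp: rec isrec_def)
  qed (use syms_q in simp)
  then show ?thesis by (simp add: rec)
qed

end

subsection \<open>The cumulative hierarchy\<close>

context zf_model
begin

lemma recursion_V: "recursion E R I K sub (Sub 0 1) (\<lambda>_. undefined)"
  by unfold_locales (simp_all add: power)

text \<open>The recursion puts in \<open>x\<close>, keeps what is there and adds elements of
  elements. Along a limit ordinal every stage is followed by another one, which supplies the
  elements of its members.\<close>

lemma transitive_superset: "\<exists>t. x \<epsilon> t \<and> (\<forall>y z. y \<epsilon> t \<longrightarrow> z \<epsilon> y \<longrightarrow> z \<epsilon> t)"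
proof -
  let ?Q = "\<lambda>z u. z = x \<or> z \<epsilon> u \<or> (\<exists>t. t \<epsilon> u \<and> z \<epsilon> t)"
  interpret recursion E R I K ?Q "0 \<^bold>= 2 \<^bold>\<or> 0 \<^bold>\<in> 1 \<^bold>\<or> BEx 1 (1 \<^bold>\<in> 0)" "x \<cdot> (\<lambda>_. undefined)"
  proof unfold_locales
    fix u
    obtain v where v: "\<And>z. z \<epsilon> v \<longleftrightarrow> (\<exists>t. t \<epsilon> u \<and> z \<epsilon> t)" using union by metis
    obtain w where w: "\<And>z. z \<epsilon> w \<longleftrightarrow> z \<epsilon> u \<or> z \<epsilon> v" using binary_union by metis
    obtain s where s: "\<And>z. z \<epsilon> s \<longleftrightarrow> z \<epsilon> w \<or> z = x" using insert_set by metis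
    show "\<exists>w. \<forall>z. z \<epsilon> w \<longleftrightarrow> ?Q z u" by (rule exI[of _ s]) (auto simp: s w v)
  qed auto
  obtain l m where l: "ord l" "m \<epsilon> l" and lim: "\<And>a. a \<epsilon> l \<Longrightarrow> \<exists>b. b \<epsilon> l \<and> a \<epsilon> b"
    using limit_ordinal by metis
  obtain t where t: "isrec ?Q l t" using isrec_exists[OF l(1)] by blast
  note mem = isrec_mem[OF l(1) t]
  obtain u where u: "isrec ?Q m u" using isrec_exists[OF ord_mem[OF l]] by blast
  have "x \<epsilon> t" using mem[of x] l u by blast
  moreover have "z \<epsilon> t" if yt: "y \<epsilon> t" and zy: "z \<epsilon> y" for y z
  proof -
    obtain g u where g: "g \<epsilon> l" "isrec ?Q g u" "?Q y u" using mem[of y] yt by blast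
    obtain b where b: "b \<epsilon> l" "g \<epsilon> b" using lim[OF g(1)] by blast
    obtain v where v: "isrec ?Q b v" using isrec_exists[OF ord_mem[OF l(1) b(1)]] by blast
    have "y \<epsilon> v" using isrec_mem[OF ord_mem[OF l(1) b(1)] v, of y] b(2) g by blast
    then show ?thesis using mem[of z] b(1) v zy by blast
  qed
  ultimately show ?thesis by blast
qed

lemma V_set: "ord a \<Longrightarrow> \<exists>v. \<forall>z. z \<epsilon> v \<longleftrightarrow> inV z a"
  using recursion.isrec_exists[OF recursion_V] recursion.isrec_unique[OF recursion_V]
  unfolding inV_def by metis

text \<open>Hides the recursion: from here on the levels are handled through membership
  alone.\<close>

lemma inV_iff: assumes "ord a" shows "inV z a \<longleftrightarrow> (\<exists>g. g \<epsilon> a \<and> (\<forall>w. w \<epsilon> z \<longrightarrow> inV w g))"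
proof -
  obtain v where v: "isrec sub a v" using recursion.isrec_exists[OF recursion_V assms] by blast
  have "inV z a \<longleftrightarrow> z \<epsilon> v"
    unfolding inV_def using v recursion.isrec_unique[OF recursion_V assms v] by blast
  moreover have "z \<epsilon> v \<longleftrightarrow> (\<exists>g u. g \<epsilon> a \<and> isrec sub g u \<and> sub z u)"
    by (rule recursion.isrec_mem[OF recursion_V assms v])
  moreover have "(\<exists>u. isrec sub g u \<and> sub z u) \<longleftrightarrow> (\<forall>w. w \<epsilon> z \<longrightarrow> inV w g)" if "g \<epsilon> a" for g
  proof -
    have g: "ord g" using ord_mem[OF assms that] .
    obtain u where u: "isrec sub g u" using recursion.isrec_exists[OF recursion_V g] by blast
    show ?thesis unfolding inV_def sub_def[of z] using u recursion.isrec_unique[OF recursion_V g u] by blast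
  qed
  ultimately show ?thesis by blast
qed

lemma inV_mono: assumes "ord b" "a \<epsilon> b" "inV z a" shows "inV z b"
  using assms(3) ord_trans[OF assms(1) _ assms(2)]
  unfolding inV_iff[OF assms(1)] inV_iff[OF ord_mem[OF assms(1,2)]] by blast

lemma inV_bound:
  assumes "\<And>z. z \<epsilon> x \<Longrightarrow> \<exists>a. ord a \<and> inV z a"
  shows "\<exists>b. ord b \<and> (\<forall>z. z \<epsilon> x \<longrightarrow> inV z b)"
proof -
  let ?p = "Ord 1 \<^bold>\<and> InV 0 1"
  have "\<exists>w. \<forall>z. z \<epsilon> x \<longrightarrow> (\<exists>a. a \<epsilon> w \<and> sat (z \<cdot> a \<cdot> (\<lambda>_. undefined)) ?p)"
    by (rule coll) (use assms in simp_all)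
  then obtain w where w: "\<And>z. z \<epsilon> x \<Longrightarrow> \<exists>a. a \<epsilon> w \<and> ord a \<and> inV z a" by auto
  obtain b where b: "ord b" "\<forall>a. a \<epsilon> w \<longrightarrow> ord a \<longrightarrow> a \<epsilon> b" using ord_bound by blast
  then show ?thesis using w inV_mono[OF b(1)] by blast
qed

text \<open>Foundation speaks about sets, so it is applied to those elements of a transitive
  superset of \<open>x\<close> that lie in no level. All members of a minimal such element lie in
  levels with a common bound \<open>b\<close>, which puts the element itself into the level of the
  successor of \<open>b\<close>.\<close>

lemma in_some_V: "\<exists>a. ord a \<and> inV x a"
proof (rule ccontr)
  assume x: "\<not> (\<exists>a. ord a \<and> inV x a)"
  obtain t where t: "x \<epsilon> t" "\<And>y z. y \<epsilon> t \<Longrightarrow> z \<epsilon> y \<Longrightarrow> z \<epsilon> t" using transitive_superset by blast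
  have "\<exists>w. \<forall>y. y \<epsilon> w \<longleftrightarrow> y \<epsilon> t \<and> sat (y \<cdot> (\<lambda>_. undefined)) (Neg (Ex (Ord 0 \<^bold>\<and> InV 1 0)))"
    by (rule sep) simp
  then obtain w where w: "\<And>y. y \<epsilon> w \<longleftrightarrow> y \<epsilon> t \<and> \<not> (\<exists>a. ord a \<and> inV y a)" by auto
  have "x \<epsilon> w" using w x t(1) by blast
  then obtain y where y: "y \<epsilon> w" "\<forall>z. z \<epsilon> w \<longrightarrow> \<not> z \<epsilon> y" using foundation by blast
  have "\<exists>a. ord a \<and> inV z a" if "z \<epsilon> y" for z
    using w[of z] w[of y] y that t(2)[of y z] by blast
  then obtain b where b: "ord b" "\<forall>z. z \<epsilon> y \<longrightarrow> inV z b" using inV_bound by blast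
  obtain s where s: "ord s" "\<forall>z. z \<epsilon> s \<longleftrightarrow> z \<epsilon> b \<or> z = b" using ord_succ[OF b(1)] by blast
  have "inV y s" unfolding inV_iff[OF s(1)] using b(2) s(2) by blast
  then show False using w[of y] y(1) s(1) by blast
qed

lemma set_in_V: "\<exists>b. ord b \<and> (\<forall>z. z \<epsilon> x \<longrightarrow> inV z b)"
  using inV_bound in_some_V by blast

end

section \<open>Blocks of quantifiers and bounds on free variables\<close>

text \<open>The environment below \<open>Alls n\<close>. A total function \<open>x\<close> stands
  for the tuple; entry 0 is bound innermost and entry \<open>n - 1\<close> outermost.\<close>

definition join :: "nat \<Rightarrow> (nat \<Rightarrow> 'a) \<Rightarrow> (nat \<Rightarrow> 'a) \<Rightarrow> nat \<Rightarrow> 'a" where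
  "join n x e = (\<lambda>v. if v < n then x v else e (v - n))"

lemma join_0 [simp]: "join 0 x e = e"
  by (simp add: join_def)

lemma join_Suc: "join (Suc n) x e = join n x (x n \<cdot> e)"
proof
  fix v
  show "join (Suc n) x e v = join n x (x n \<cdot> e) v"
  proof (cases "v \<le> n")
    case True
    then show ?thesis by (cases "v = n") (auto simp: join_def)
  next
    case False
    then obtain k where "v = Suc (n + k)" by (metis add_Suc less_iff_Suc_add not_le)
    then show ?thesis by (simp add: join_def Suc_diff_le)
  qed
qed

lemma join_cong: "(\<And>m. m < n \<Longrightarrow> x m = y m) \<Longrightarrow> join n x e = join n y e"
  by (auto simp: join_def)

lemma join_less [simp]: "v < n \<Longrightarrow> join n x e v = x v"
  by (simp add: join_def)

lemma join_ge [simp]: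
  "join n x e (n + k) = e k" "join n x e (k + n) = e k" "join n x e n = e 0"
  "join n x e (Suc n) = e 1" "join n x e (Suc (Suc n)) = e 2" "join n x e (Suc (n + k)) = e (Suc k)" "join n x e (Suc (k + n)) = e (Suc k)"
  by (simp_all add: join_def Suc_diff_le numeral_2_eq_2)

lemma ball_upt [simp]: "(\<forall>m \<in> {0..<n}. P m) \<longleftrightarrow> (\<forall>m < n. P m)" for n :: nat
  by auto

lemma sat_Alls [simp]: "sat_eq Q E R I e (Alls n p) = (\<forall>x. sat_eq Q E R I (join n x e) p)"
proof (induction n arbitrary: e)
  case 0
  then show ?case by (simp add: Alls_def)
next
  case (Suc n)
  have "sat_eq Q E R I e (Alls (Suc n) p) = (\<forall>a x. sat_eq Q E R I (join n x (a \<cdot> e)) p)"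
    using Suc by (simp add: Alls_def)
  also have "\<dots> = (\<forall>x. sat_eq Q E R I (join (Suc n) x e) p)"
  proof (intro iffI allI)
    fix a x assume a: "\<forall>x. sat_eq Q E R I (join (Suc n) x e) p"
    have "join (Suc n) (x(n := a)) e = join n x (a \<cdot> e)"
      by (simp add: join_Suc join_cong[of n "x(n := a)" x])
    then show "sat_eq Q E R I (join n x (a \<cdot> e)) p" using a by metis
  qed (simp add: join_Suc)
  finally show ?case .
qed

lemma sat_app: "sat_eq Q E R I e (app p vs) = sat_eq Q E R I (\<lambda>m. e (vs ! m)) p"
  by (simp add: app_def sat_rename)

text \<open>Passing a quantifier only raises the bound by one, so closedness of the axioms and
  membership in \<open>formulas\<close> reduce to arithmetic on indices.\<close>

definition below :: "nat \<Rightarrow> fm \<Rightarrow> bool" where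
  "below k p \<longleftrightarrow> fv p \<subseteq> {..<k}"

lemma below_All [simp]: "below k (All p) = below (Suc k) p"
  unfolding below_def by (auto simp: subset_iff) (metis less_Suc_eq_0_disj not0_implies_Suc Suc_less_eq)+

lemma below_simps [simp]:
  "below k (a \<^bold>= b) = (a < k \<and> b < k)" "below k (a \<^bold>\<in> b) = (a < k \<and> b < k)"
  "below k (a \<^bold>< b) = (a < k \<and> b < k)" "below k (InI a) = (a < k)" "below k Bot"
  "below k (p \<^bold>\<longrightarrow> q) = (below k p \<and> below k q)"
  by (auto simp: below_def)

lemma below_connectives [simp]:
  "below k (Neg p) = below k p" "below k Top" "below k (p \<^bold>\<or> q) = (below k p \<and> below k q)"
  "below k (p \<^bold>\<and> q) = (below k p \<and> below k q)" "below k (p \<^bold>\<longleftrightarrow> q) = (below k p \<and> below k q)"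
  "below k (Ex p) = below (Suc k) p" "below k (BAll v p) = (v < k \<and> below (Suc k) p)"
  "below k (BEx v p) = (v < k \<and> below (Suc k) p)"
  by (auto simp: Neg_def Top_def Or_def And_def Iff_def Ex_def BAll_def BEx_def)

lemma below_Alls [simp]: "below k (Alls n p) = below (n + k) p"
  by (induction n arbitrary: k) (simp_all add: Alls_def)

lemma below_Conj [simp]: "below k (Conj ps) = (\<forall>p \<in> set ps. below k p)"
  by (induction ps) (simp_all add: Conj_def)

lemma below_set_notions [simp]:
  "below k (Sub a b) = (a < k \<and> b < k)" "below k (Nonempty a) = (a < k)"
  "below k (IsSucc a b) = (a < k \<and> b < k)" "below k (IsUPair c a b) = (a < k \<and> b < k \<and> c < k)"
  by (auto simp: Sub_def Nonempty_def IsSucc_def IsUPair_def)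

lemma below_IsOPair [simp]: "below k (IsOPair c a b) = (a < k \<and> b < k \<and> c < k)"
  by (auto simp: IsOPair_def)

lemma below_Maps [simp]: "below k (Maps c a b) = (a < k \<and> b < k \<and> c < k)"
  by (auto simp: Maps_def)

lemma below_Ord [simp]: "below k (Ord a) = (a < k)"
  by (auto simp: Ord_def)

lemma below_IsV [simp]: "below k (IsV a b) = (a < k \<and> b < k)"
  by (auto simp: IsV_def)

lemma below_InV [simp]: "below k (InV a b) = (a < k \<and> b < k)"
  by (auto simp: InV_def)

lemma below_IncrI [simp]: "below k (IncrI vs) = (\<forall>v \<in> set vs. v < k)"
  by (induction vs rule: IncrI.induct) auto

lemma below_rename: "below n p \<Longrightarrow> (\<And>m. m < n \<Longrightarrow> f m < k) \<Longrightarrow> below k (rename f p)"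
  by (auto simp: below_def fv_rename)

lemma below_mono: "below n p \<Longrightarrow> n \<le> k \<Longrightarrow> below k p"
  by (auto simp: below_def)

lemma below_app: "below (length vs) p \<Longrightarrow> (\<And>v. v \<in> set vs \<Longrightarrow> v < k) \<Longrightarrow> below k (app p vs)"
  unfolding app_def by (rule below_rename) auto

lemma syms_IncrI: "syms (IncrI vs) \<subseteq> {ISym}"
  by (induction vs rule: IncrI.induct) auto

lemma sat_cong_below:
  "below k p \<Longrightarrow> (\<And>v. v < k \<Longrightarrow> e v = e' v) \<Longrightarrow> sat_eq Q E R I e p = sat_eq Q E R I e' p"
  by (rule sat_cong) (auto simp: below_def)

lemma formulas_iff: "p \<in> formulas L k \<longleftrightarrow> syms p \<subseteq> L \<and> below k p"
  by (simp add: formulas_def below_def)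

section \<open>Models with indiscernibles\<close>

context interpretation_of_symbols
begin

definition incr :: "nat \<Rightarrow> (nat \<Rightarrow> 'a) \<Rightarrow> bool" where
  "incr n x \<longleftrightarrow> (\<forall>m < n. I (x m)) \<and> (\<forall>m. Suc m < n \<longrightarrow> x m \<epsilon> x (Suc m))"

lemma sat_IncrI [simp]: "sat e (IncrI vs) = incr (length vs) (\<lambda>m. e (vs ! m))"
proof (induction vs rule: IncrI.induct)
  case (3 u v vs)
  have "incr (Suc (Suc n)) x \<longleftrightarrow> I (x 0) \<and> x 0 \<epsilon> x 1 \<and> incr (Suc n) (\<lambda>m. x (Suc m))" for n x
    unfolding incr_def by (simp add: All_less_Suc2) blast
  then show ?case using 3 by simp
qed (simp_all add: incr_def)

text \<open>\<open>t\<close> codes the tuple \<open>x 0, \<dots>, x (n - 1)\<close>; the last pair component is arbitrary.\<close>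
primrec coded :: "nat \<Rightarrow> 'a \<Rightarrow> (nat \<Rightarrow> 'a) \<Rightarrow> bool" where
  "coded 0 t x = True"
| "coded (Suc n) t x = (\<exists>u. opair t (x n) u \<and> coded n u x)"

primrec Coded :: "nat \<Rightarrow> nat \<Rightarrow> nat \<Rightarrow> fm" where
  "Coded 0 t k = Top"
| "Coded (Suc n) t k = Ex (IsOPair (Suc t) (Suc (k + n)) 0 \<^bold>\<and> Coded n 0 (Suc k))"

lemma sat_Coded [simp]: "sat e (Coded n t k) = coded n (e t) (\<lambda>m. e (k + m))"
  by (induction n arbitrary: e t k) simp_all

lemma coded_cong: "(\<And>m. m < n \<Longrightarrow> x m = y m) \<Longrightarrow> coded n t x = coded n t y"
  by (induction n arbitrary: t) simp_all

lemma coded_join [simp]: "coded n t (join n x e) = coded n t x"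
  by (rule coded_cong) simp

lemma incr_cong: "(\<And>m. m < n \<Longrightarrow> x m = y m) \<Longrightarrow> incr n x = incr n y"
  by (auto simp: incr_def)

lemma syms_Coded [simp]: "syms (Coded n t k) = {}"
  by (induction n arbitrary: t k) simp_all

end

context zf_model
begin

section \<open>Tuples in the model\<close>

lemma coded_exists: "\<exists>t. coded n t x"
  by (induction n) (simp, metis coded.simps(2) opair_exists)

lemma coded_inject: "coded n t x \<Longrightarrow> coded n t y \<Longrightarrow> m < n \<Longrightarrow> x m = y m"
proof (induction n arbitrary: t)
  case (Suc n)
  then obtain u u' where u: "opair t (x n) u" "coded n u x" "opair t (y n) u'" "coded n u' y" by auto
  then have eq: "x n = y n" "u = u'" using opair_inject by blast+
  show ?case
  proof (cases "m = n")
    case True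
    then show ?thesis using eq by simp
  next
    case False
    then show ?thesis using Suc u eq by auto
  qed
qed simp

text \<open>By induction on \<open>n\<close>, without forming a set of tuples. For a fixed last
  entry \<open>c\<close> the hypothesis gives a bound; being a bound for \<open>c\<close> is
  expressible by a formula, so collection over \<open>c\<close> and a union give a bound that suits
  all \<open>c\<close>.\<close>

lemma coll_tuples:
  assumes "syms p \<subseteq> insert ISym K"
  shows "\<exists>b. \<forall>x. (\<forall>m < n. x m \<epsilon> a) \<longrightarrow> (\<exists>y. sat (y \<cdot> join n x e) p) \<longrightarrow>
    (\<exists>y. y \<epsilon> b \<and> sat (y \<cdot> join n x e) p)"
proof (induction n arbitrary: e)
  case 0
  show ?case
  proof (cases "\<exists>y. sat (y \<cdot> e) p")
    case True
    then obtain y where y: "sat (y \<cdot> e) p" by blast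
    obtain b where "\<forall>z. z \<epsilon> b \<longleftrightarrow> z = y \<or> z = y" using pairing by blast
    then show ?thesis using y by auto
  qed auto
next
  case (Suc n)
  let ?good = "\<lambda>e b. \<forall>x. (\<forall>m < n. x m \<epsilon> a) \<longrightarrow> (\<exists>y. sat (y \<cdot> join n x e) p) \<longrightarrow>
    (\<exists>y. y \<epsilon> b \<and> sat (y \<cdot> join n x e) p)"
  \<comment> \<open>Below the quantifiers of \<open>?q\<close> the sets \<open>b\<close> and
    \<open>a\<close> stand between \<open>c\<close>, at index \<open>n + 1\<close>, and the
    parameters \<open>e\<close>; so \<open>p\<close> keeps its first \<open>n + 2\<close> arguments
    and shifts the others by 2.\<close>
  let ?p = "rename (\<lambda>m. if m \<le> Suc n then m else m + 2) p"
  let ?q = "Alls n (Conj (map (\<lambda>m. m \<^bold>\<in> n + 2) [0..<n]) \<^bold>\<longrightarrow> Ex ?p \<^bold>\<longrightarrow> BEx (Suc n) ?p)"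
  have env: "(\<lambda>m. (y \<cdot> join n x (c \<cdot> b \<cdot> a \<cdot> e)) (if m \<le> Suc n then m else m + 2)) = y \<cdot> join n x (c \<cdot> e)"
    for x y b c
  proof
    fix m
    show "(y \<cdot> join n x (c \<cdot> b \<cdot> a \<cdot> e)) (if m \<le> Suc n then m else m + 2) = (y \<cdot> join n x (c \<cdot> e)) m"
    proof (cases "m \<le> Suc n")
      case True
      then show ?thesis by (cases m; cases "m = Suc n") auto
    next
      case False
      then obtain k where k: "m = Suc (Suc (n + k))" using less_iff_Suc_add[of "Suc n" m] by auto
      have "join n x (c \<cdot> b \<cdot> a \<cdot> e) (Suc (n + Suc (Suc k))) = e k" by (simp only: join_ge scons_simps)
      then show ?thesis using k by simp
    qed
  qed
  have q: "sat (c \<cdot> b \<cdot> a \<cdot> e) ?q \<longleftrightarrow> ?good (c \<cdot> e) b" for b c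
    by (simp add: sat_rename env)
  have "\<exists>w. \<forall>c. c \<epsilon> a \<longrightarrow> (\<exists>b. b \<epsilon> w \<and> sat (c \<cdot> b \<cdot> a \<cdot> e) ?q)"
  proof (rule coll)
    show "\<exists>b. sat (c \<cdot> b \<cdot> a \<cdot> e) ?q" for c unfolding q by (rule Suc)
  qed (use assms in auto)
  then obtain w where w: "\<And>c. c \<epsilon> a \<Longrightarrow> \<exists>b. b \<epsilon> w \<and> ?good (c \<cdot> e) b" unfolding q by blast
  obtain u where u: "\<And>z. z \<epsilon> u \<longleftrightarrow> (\<exists>b. b \<epsilon> w \<and> z \<epsilon> b)" using union by metis
  have "\<exists>y. y \<epsilon> u \<and> sat (y \<cdot> join (Suc n) x e) p"
    if x: "\<forall>m < Suc n. x m \<epsilon> a" and y: "\<exists>y. sat (y \<cdot> join (Suc n) x e) p" for x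
  proof -
    obtain b where b: "b \<epsilon> w" "?good (x n \<cdot> e) b" using w[of "x n"] x by blast
    have "\<exists>y. y \<epsilon> b \<and> sat (y \<cdot> join n x (x n \<cdot> e)) p"
      using b(2) x y unfolding join_Suc by simp
    then show ?thesis using u b(1) unfolding join_Suc by blast
  qed
  then show ?case by blast
qed

end

section \<open>Cofinal indiscernibles\<close>

locale indiscernible_model = zf_model +
  assumes I_ord: "I i \<Longrightarrow> ord i" and I_cofinal: "ord a \<Longrightarrow> \<exists>i. I i \<and> (a \<epsilon> i \<or> a = i)"
    and indis: "p \<in> formulas K n \<Longrightarrow> incr n x \<Longrightarrow> incr n y \<Longrightarrow> sat x p \<longleftrightarrow> sat y p"
begin

lemma I_above: assumes "ord a" shows "\<exists>i. I i \<and> a \<epsilon> i"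
proof -
  obtain s where s: "ord s" "\<forall>z. z \<epsilon> s \<longleftrightarrow> z \<epsilon> a \<or> z = a" using ord_succ[OF assms] by blast
  obtain i where "I i" "s \<epsilon> i \<or> s = i" using I_cofinal[OF s(1)] by blast
  then show ?thesis using s ord_trans[OF I_ord] by blast
qed

text \<open>The sequence is chosen outside the model, by iterating \<open>f\<close>. This suffices
  because a formula reads only finitely many of its entries.\<close>

lemma incr_above: assumes "ord a" shows "\<exists>x. a \<epsilon> x 0 \<and> (\<forall>n. incr n x)"
proof -
  obtain f where f: "\<And>b. ord b \<Longrightarrow> I (f b) \<and> b \<epsilon> f b" using I_above by metis
  define x where "x m = (f ^^ Suc m) a" for m
  have I: "I (x m)" for m
    by (induction m) (use f assms I_ord in \<open>auto simp: x_def\<close>)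
  moreover have "x m \<epsilon> x (Suc m)" for m using f[OF I_ord[OF I[of m]]] by (simp add: x_def)
  moreover have "a \<epsilon> x 0" using f[OF assms] by (simp add: x_def)
  ultimately show ?thesis unfolding incr_def by blast
qed

lemma ord_above_two: assumes "ord a" "ord b" shows "\<exists>c. ord c \<and> a \<epsilon> c \<and> b \<epsilon> c"
proof -
  obtain p where p: "\<forall>z. z \<epsilon> p \<longleftrightarrow> z = a \<or> z = b" using pairing by blast
  then show ?thesis using ord_bound[of p] assms by blast
qed

theorem apartness_model:
  assumes p: "p \<in> formulas K (n + 1)" and ij: "I i" "I j" "i \<epsilon> j"
    and x: "\<And>m. m < n \<Longrightarrow> inV (x m) i" and y: "sat (join n x (\<lambda>_. y)) p"
  shows "\<exists>y. inV y j \<and> sat (join n x (\<lambda>_. y)) p"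
proof -
  let ?p = "rename (\<lambda>m. if m < n then Suc m else 0) p"
  \<comment> \<open>The tuple is quantified inside \<open>?q\<close>, so only \<open>i\<close> and
    \<open>j\<close> remain as arguments, at the indices 0 and 1.\<close>
  let ?q = "Alls n (Conj (map (\<lambda>m. InV m n) [0..<n]) \<^bold>\<longrightarrow> Ex ?p \<^bold>\<longrightarrow> Ex (InV 0 (n + 2) \<^bold>\<and> ?p))"
  have env: "(\<lambda>m. (z \<cdot> join n x e) (if m < n then Suc m else 0)) = join n x (\<lambda>_. z)" for z x e
    by (auto simp: join_def)
  have rp: "sat (z \<cdot> join n x e) ?p = sat (join n x (\<lambda>_. z)) p" for z x e
    by (simp only: sat_rename env)
  have q: "sat e ?q \<longleftrightarrow> (\<forall>x. (\<forall>m < n. inV (x m) (e 0)) \<longrightarrow> (\<exists>y. sat (join n x (\<lambda>_. y)) p) \<longrightarrow>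
      (\<exists>y. inV y (e 1) \<and> sat (join n x (\<lambda>_. y)) p))" for e
    by (simp add: rp)
  have "?q \<in> formulas K 2"
    using p by (auto simp: formulas_iff intro!: below_rename[of "n + 1"])
  then have indis_q: "sat (a \<cdot> b \<cdot> (\<lambda>_. a)) ?q \<longleftrightarrow> sat (c \<cdot> d \<cdot> (\<lambda>_. c)) ?q"
    if "I a" "I b" "a \<epsilon> b" "I c" "I d" "c \<epsilon> d" for a b c d
    by (rule indis) (use that in \<open>auto simp: incr_def less_2_cases_iff less_Suc_eq\<close>)
  have "ord i" using I_ord[OF ij(1)] .
  obtain v where v: "\<forall>z. z \<epsilon> v \<longleftrightarrow> inV z i" using V_set[OF \<open>ord i\<close>] by blast
  have "\<exists>b. \<forall>x. (\<forall>m < n. x m \<epsilon> v) \<longrightarrow> (\<exists>y. sat (y \<cdot> join n x (\<lambda>_. i)) ?p) \<longrightarrow>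
      (\<exists>y. y \<epsilon> b \<and> sat (y \<cdot> join n x (\<lambda>_. i)) ?p)"
    by (rule coll_tuples) (use p in \<open>auto simp: formulas_iff\<close>)
  then obtain b where b: "\<forall>x. (\<forall>m < n. inV (x m) i) \<longrightarrow> (\<exists>y. sat (join n x (\<lambda>_. y)) p) \<longrightarrow>
      (\<exists>y. y \<epsilon> b \<and> sat (join n x (\<lambda>_. y)) p)"
    unfolding rp v[rule_format] by (elim exE)
  \<comment> \<open>The collected witnesses form a mere set \<open>b\<close>; a level that includes
    it turns the bound into an ordinal \<open>c\<close>.\<close>
  obtain c where c: "ord c" "\<forall>z. z \<epsilon> b \<longrightarrow> inV z c" using set_in_V by blast
  obtain d where d: "ord d" "i \<epsilon> d" "c \<epsilon> d" using ord_above_two[OF \<open>ord i\<close> c(1)] by blast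
  obtain k where k: "I k" "d \<epsilon> k" using I_above[OF d(1)] by blast
  have ik: "i \<epsilon> k" and ck: "c \<epsilon> k" using ord_trans[OF I_ord[OF k(1)] _ k(2)] d by blast+
  have "sat (i \<cdot> k \<cdot> (\<lambda>_. i)) ?q"
    unfolding q
  proof (intro allI impI)
    fix x assume "\<forall>m < n. inV (x m) ((i \<cdot> k \<cdot> (\<lambda>_. i)) 0)" "\<exists>y. sat (join n x (\<lambda>_. y)) p"
    then obtain y where y: "y \<epsilon> b" "sat (join n x (\<lambda>_. y)) p" using b by auto
    then have "inV y k" using c(2) inV_mono[OF I_ord[OF k(1)] ck] by blast
    then show "\<exists>y. inV y ((i \<cdot> k \<cdot> (\<lambda>_. i)) 1) \<and> sat (join n x (\<lambda>_. y)) p" using y(2) by auto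
  qed
  then have "sat (i \<cdot> j \<cdot> (\<lambda>_. i)) ?q" using indis_q ij k(1) ik by blast
  then show ?thesis unfolding q using x y by auto
qed

theorem diagonal_model:
  assumes p: "p \<in> formulas K (n + 1 + r)" and r: "r \<ge> 1" and i: "I i"
    and j: "incr r j" "i \<epsilon> j 0" and k: "incr r k" "i \<epsilon> k 0" and x: "\<And>m. m < n \<Longrightarrow> inV (x m) i"
  shows "sat (join n x (i \<cdot> j)) p \<longleftrightarrow> sat (join n x (i \<cdot> k)) p"
proof -
  let ?p = "rename (\<lambda>m. if m \<le> n then m else m + r) p"
  \<comment> \<open>The arguments of \<open>?q\<close> are the \<open>1 + 2 * r\<close> entries of
    \<open>i, j, l\<close>. The renaming in \<open>?p\<close> skips the block of \<open>j\<close>,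
    so that \<open>?p\<close> reads \<open>l\<close> in its place.\<close>
  let ?q = "Alls n (Conj (map (\<lambda>m. InV m n) [0..<n]) \<^bold>\<longrightarrow> (p \<^bold>\<longleftrightarrow> ?p))"
  let ?agree = "\<lambda>i j l. \<forall>x. (\<forall>m < n. inV (x m) i) \<longrightarrow>
    (sat (join n x (i \<cdot> j)) p \<longleftrightarrow> sat (join n x (i \<cdot> l)) p)"
  have env1: "sat (join n x (a \<cdot> join r j l)) p \<longleftrightarrow> sat (join n x (a \<cdot> j)) p" for x a j l
  proof (rule sat_cong_below)
    show "below (n + 1 + r) p" using p by (simp add: formulas_iff)
    show "join n x (a \<cdot> join r j l) v = join n x (a \<cdot> j) v" if "v < n + 1 + r" for v
    proof (cases "v \<le> n")
      case True
      then show ?thesis by (cases "v = n") auto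
    next
      case False
      then obtain m where m: "v = Suc (n + m)" using less_iff_Suc_add[of n v] by auto
      then show ?thesis using that by simp
    qed
  qed
  have env2: "(\<lambda>v. join n x (a \<cdot> join r j l) (if v \<le> n then v else v + r)) = join n x (a \<cdot> l)" for x a j l
  proof
    fix v
    show "join n x (a \<cdot> join r j l) (if v \<le> n then v else v + r) = join n x (a \<cdot> l) v"
    proof (cases "v \<le> n")
      case True
      then show ?thesis by (cases "v = n") auto
    next
      case False
      then obtain m where m: "v = Suc (n + m)" using less_iff_Suc_add[of n v] by auto
      have "join n x (a \<cdot> join r j l) (Suc (n + (m + r))) = l m" by (simp only: join_ge scons_simps)
      then show ?thesis using m by (simp add: add.assoc)
    qed
  qed
  have q: "sat (i \<cdot> join r j l) ?q \<longleftrightarrow> ?agree i j l" for i j l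
    by (simp add: sat_rename env1 env2)
  have q_formula: "?q \<in> formulas K (1 + 2 * r)"
  proof -
    have "below (n + 1 + r) p" using p by (simp add: formulas_iff)
    then have "below (n + (1 + 2 * r)) p" "below (n + (1 + 2 * r)) ?p"
      by (rule below_mono, simp) (rule below_rename[OF \<open>below (n + 1 + r) p\<close>], simp)
    then show ?thesis using p by (auto simp: formulas_iff)
  qed
  have incr_join: "incr (1 + 2 * r) (i \<cdot> join r j l)"
    if "I i" "incr r j" "incr r l" "i \<epsilon> j 0" "j (r - 1) \<epsilon> l 0" for i j l
    unfolding incr_def
  proof (intro conjI allI impI)
    fix m assume m: "m < 1 + 2 * r"
    show "I ((i \<cdot> join r j l) m)"
      using that(1-3) m by (cases m) (auto simp: incr_def join_def)
  next
    fix m assume m: "Suc m < 1 + 2 * r"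
    show "(i \<cdot> join r j l) m \<epsilon> (i \<cdot> join r j l) (Suc m)"
    proof (cases m)
      case 0
      then show ?thesis using that r by simp
    next
      case (Suc t)
      consider "Suc t < r" | "Suc t = r" | "t \<ge> r" by linarith
      then show ?thesis
      proof cases
        case 1
        then show ?thesis using that(2) Suc by (simp add: incr_def)
      next
        case 2
        then have "t < r" "t = r - 1" "m = r" using Suc by auto
        have "(i \<cdot> join r j l) m = j (r - 1)" unfolding Suc scons_simps \<open>t = r - 1\<close> using r by simp
        moreover have "(i \<cdot> join r j l) (Suc m) = l 0" using \<open>m = r\<close> by simp
        ultimately show ?thesis using that(5) by simp
      next
        case 3
        then have "Suc (t - r) < r" "Suc t - r = Suc (t - r)" using m Suc by auto
        then show ?thesis using that(3) Suc 3 by (simp add: incr_def join_def)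
      qed
    qed
  qed
  have agree: "?agree i j l"
    if I: "I i" "incr r j" "incr r l" "i \<epsilon> j 0" "j (r - 1) \<epsilon> l 0" for i j l
  proof (rule ccontr)
    assume neg: "\<not> ?agree i j l"
    have neg: "\<not> ?agree i j' l'"
      if "incr r j'" "incr r l'" "i \<epsilon> j' 0" "j' (r - 1) \<epsilon> l' 0" for j' l'
      using neg indis[OF q_formula incr_join[OF I] incr_join[OF I(1) that]] unfolding q by blast
    have "ord i" using I_ord[OF I(1)] .
    obtain v where v: "\<forall>z. z \<epsilon> v \<longleftrightarrow> inV z i" using V_set[OF \<open>ord i\<close>] by blast
    \<comment> \<open>\<open>t\<close> contains a code of each tuple from \<open>V(i)\<close>, and
      possibly other elements. Collecting codes spares the construction of a product; subsets of
      \<open>t\<close> play the role of subsets of the product.\<close>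
    have "\<exists>t. \<forall>x. (\<forall>m < n. x m \<epsilon> v) \<longrightarrow> (\<exists>y. sat (y \<cdot> join n x (\<lambda>_. i)) (Coded n 0 1)) \<longrightarrow>
        (\<exists>y. y \<epsilon> t \<and> sat (y \<cdot> join n x (\<lambda>_. i)) (Coded n 0 1))"
      by (rule coll_tuples) simp
    then obtain t where t: "\<And>x. (\<forall>m < n. inV (x m) i) \<Longrightarrow> \<exists>y. y \<epsilon> t \<and> coded n y x"
      using v coded_exists by auto
    define G where "G s j \<longleftrightarrow> (\<forall>y. y \<epsilon> t \<longrightarrow> (y \<epsilon> s \<longleftrightarrow> (\<exists>x. coded n y x \<and> sat (join n x (i \<cdot> j)) p)))" for s j
    \<comment> \<open>Each tuple from \<open>V(i)\<close> has a code in \<open>t\<close>, and a code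
      determines its tuple; so a trace \<open>s\<close> shared by \<open>j'\<close> and
      \<open>l'\<close> decides \<open>p\<close> for both of them on \<open>V(i)\<close>.\<close>
    have G_agree: "?agree i j' l'" if "G s j'" "G s l'" for s j' l'
    proof (intro allI impI)
      fix x assume "\<forall>m < n. inV (x m) i"
      then obtain y where y: "y \<epsilon> t" "coded n y x" using t by blast
      have "(\<exists>x'. coded n y x' \<and> sat (join n x' (i \<cdot> j)) p) \<longleftrightarrow> sat (join n x (i \<cdot> j)) p" for j
      proof
        assume "\<exists>x'. coded n y x' \<and> sat (join n x' (i \<cdot> j)) p"
        then obtain x' where x': "coded n y x'" "sat (join n x' (i \<cdot> j)) p" by blast
        have "join n x' (i \<cdot> j) = join n x (i \<cdot> j)"
          by (rule join_cong) (rule coded_inject[OF x'(1) y(2)])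
        then show "sat (join n x (i \<cdot> j)) p" using x'(2) by simp
      qed (use y(2) in blast)
      then show "sat (join n x (i \<cdot> j')) p \<longleftrightarrow> sat (join n x (i \<cdot> l')) p"
        using that y(1) unfolding G_def by blast
    qed
    \<comment> \<open>Below the quantifiers the element of \<open>t\<close> has index
      \<open>n\<close>, where \<open>p\<close> expects \<open>i\<close>. The entries of
      \<open>j\<close> already stand at \<open>n + 1\<close> to \<open>n + r\<close>; they are
      followed by \<open>s\<close>, \<open>y\<close>, \<open>t\<close> and then \<open>i\<close>, at
      \<open>n + r + 4\<close>.\<close>
    let ?P = "rename (\<lambda>m. if m = n then n + r + 4 else m) p"
    let ?G = "BAll (r + 2) (0 \<^bold>\<in> r + 1 \<^bold>\<longleftrightarrow> Neg (Alls n (Neg (Coded n n 0 \<^bold>\<and> ?P))))"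
    \<comment> \<open>Collection provides a single set for each \<open>s\<close>, not a tuple. So
      \<open>y\<close> may be any set that has the last and largest entry of \<open>j\<close> as a
      member; a bound for the ordinals in the collected sets then bounds the whole tuple.\<close>
    let ?H = "Neg (Alls r (Neg (IncrI [0..<r] \<^bold>\<and> r + 3 \<^bold>\<in> 0 \<^bold>\<and> r - 1 \<^bold>\<in> r + 1 \<^bold>\<and> ?G)))"
    have H: "sat (s \<cdot> y \<cdot> t \<cdot> i \<cdot> (\<lambda>_. i)) ?H \<longleftrightarrow> (\<exists>j. incr r j \<and> i \<epsilon> j 0 \<and> j (r - 1) \<epsilon> y \<and> G s j)" for s y
    proof -
      let ?e = "s \<cdot> y \<cdot> t \<cdot> i \<cdot> (\<lambda>_. i)"
      have "sat (join n x (z \<cdot> join r j ?e)) ?P \<longleftrightarrow> sat (join n x (i \<cdot> j)) p" for x z j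
        unfolding sat_rename
      proof (rule sat_cong_below)
        show "below (n + 1 + r) p" using p by (simp add: formulas_iff)
        fix u assume u: "u < n + 1 + r"
        show "join n x (z \<cdot> join r j ?e) (if u = n then n + r + 4 else u) = join n x (i \<cdot> j) u"
        proof (cases "u \<le> n")
          case True
          have "join n x (z \<cdot> join r j ?e) (n + Suc (r + 3)) = i" by (simp only: join_ge scons_simps) simp
          then show ?thesis using True by (cases "u = n") (auto simp: add.assoc)
        next
          case False
          then obtain m where m: "u = Suc (n + m)" using less_iff_Suc_add[of n u] by auto
          then show ?thesis using u by simp
        qed
      qed
      then have "sat (join r j ?e) ?G \<longleftrightarrow> G s j" for j
        by (simp add: G_def)
      moreover have "incr (length [0..<r]) (\<lambda>m. join r j ?e ([0..<r] ! m)) \<longleftrightarrow> incr r j" for j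
        unfolding length_upt diff_zero by (rule incr_cong) simp
      ultimately show ?thesis using r by simp blast
    qed
    obtain u where u: "\<forall>z. z \<epsilon> u \<longleftrightarrow> sub z t" using power by blast
    \<comment> \<open>Here collection for formulae with \<open>I\<close> is used. Subsets of
      \<open>t\<close> that are not the trace of any tuple have no witness, hence the partial
      form.\<close>
    have "\<exists>w. \<forall>s. s \<epsilon> u \<longrightarrow> (\<exists>y. sat (s \<cdot> y \<cdot> t \<cdot> i \<cdot> (\<lambda>_. i)) ?H) \<longrightarrow>
        (\<exists>y. y \<epsilon> w \<and> sat (s \<cdot> y \<cdot> t \<cdot> i \<cdot> (\<lambda>_. i)) ?H)"
      by (rule coll_partial) (use p syms_IncrI[of "[0..<r]"] in \<open>auto simp: formulas_iff\<close>)
    then obtain w where w: "\<forall>s. sub s t \<longrightarrow> (\<exists>y j. incr r j \<and> i \<epsilon> j 0 \<and> j (r - 1) \<epsilon> y \<and> G s j) \<longrightarrow>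
        (\<exists>y. y \<epsilon> w \<and> (\<exists>j. incr r j \<and> i \<epsilon> j 0 \<and> j (r - 1) \<epsilon> y \<and> G s j))"
      unfolding H u[rule_format] by (elim exE)
    obtain v where v: "\<forall>z. z \<epsilon> v \<longleftrightarrow> (\<exists>y. y \<epsilon> w \<and> z \<epsilon> y)" using union by blast
    obtain b where b: "ord b" "\<forall>a. a \<epsilon> v \<longrightarrow> ord a \<longrightarrow> a \<epsilon> b" using ord_bound by blast
    obtain c where c: "ord c" "i \<epsilon> c" "b \<epsilon> c" using ord_above_two[OF \<open>ord i\<close> b(1)] by blast
    obtain l where l: "c \<epsilon> l 0" "incr r l" "incr 1 l" using incr_above[OF c(1)] by blast
    have "ord (l 0)" using l(3) I_ord by (simp add: incr_def)
    have il: "i \<epsilon> l 0" and bl: "b \<epsilon> l 0" using ord_trans[OF \<open>ord (l 0)\<close> _ l(1)] c by blast+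
    let ?S = "Neg (Alls n (Neg (Coded n n 0 \<^bold>\<and> rename (\<lambda>m. if m < n then m else Suc m) p)))"
    have env: "(\<lambda>m. join n x (y \<cdot> i \<cdot> l) (if m < n then m else Suc m)) = join n x (i \<cdot> l)" for x y
      by (auto simp: join_def Suc_diff_le)
    have S: "sat (y \<cdot> i \<cdot> l) ?S \<longleftrightarrow> (\<exists>x. coded n y x \<and> sat (join n x (i \<cdot> l)) p)" for y
      by (simp add: sat_rename env)
    \<comment> \<open>The trace of \<open>l\<close> is a set by separation: \<open>l\<close> enters
      through parameters, and \<open>I\<close> is not mentioned.\<close>
    have "\<exists>s. \<forall>y. y \<epsilon> s \<longleftrightarrow> y \<epsilon> t \<and> sat (y \<cdot> i \<cdot> l) ?S"
      by (rule sep) (use p in \<open>simp add: formulas_iff\<close>)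
    then obtain s where s: "\<forall>y. y \<epsilon> s \<longleftrightarrow> y \<epsilon> t \<and> (\<exists>x. coded n y x \<and> sat (join n x (i \<cdot> l)) p)"
      unfolding S by blast
    have Gs: "G s l" unfolding G_def using s by blast
    have "sub s t" unfolding sub_def using s by blast
    \<comment> \<open>A singleton shows that \<open>s\<close> has a witness at all. Then
      \<open>w\<close> contains one too, and it comes from a tuple \<open>j'\<close> below
      \<open>b\<close> that has the same trace as \<open>l\<close>.\<close>
    obtain y where "\<forall>z. z \<epsilon> y \<longleftrightarrow> z = l (r - 1) \<or> z = l (r - 1)" using pairing by blast
    then have "l (r - 1) \<epsilon> y" by blast
    obtain y' j' where j': "y' \<epsilon> w" "incr r j'" "i \<epsilon> j' 0" "j' (r - 1) \<epsilon> y'" "G s j'"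
      using w[rule_format, OF \<open>sub s t\<close>] l(2) il \<open>l (r - 1) \<epsilon> y\<close> Gs by blast
    have "ord (j' (r - 1))" using j'(2) r I_ord by (simp add: incr_def)
    then have "j' (r - 1) \<epsilon> b" using b(2) v j'(1,4) by blast
    then have "j' (r - 1) \<epsilon> l 0" using ord_trans[OF \<open>ord (l 0)\<close> _ bl] by blast
    then show False using neg[OF j'(2) l(2) j'(3)] G_agree[OF j'(5) Gs] by blast
  qed
  have last: "ord (j (r - 1))" "ord (k (r - 1))" using j(1) k(1) r I_ord by (simp_all add: incr_def)
  obtain c where c: "ord c" "j (r - 1) \<epsilon> c" "k (r - 1) \<epsilon> c" using ord_above_two[OF last] by blast
  obtain l where l: "c \<epsilon> l 0" "incr r l" "incr 1 l" using incr_above[OF c(1)] by blast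
  have "ord (l 0)" using l(3) I_ord by (simp add: incr_def)
  then have "j (r - 1) \<epsilon> l 0" "k (r - 1) \<epsilon> l 0" using ord_trans[OF _ _ l(1)] c by blast+
  then have "?agree i j l" "?agree i k l" using agree i j k l(2) by blast+
  then show ?thesis using x by blast
qed

end

section \<open>The theories\<close>

text \<open>Common form of the two theories: \<open>K = {}\<close> gives \<open>ZFI\<close>, and
  \<open>K = {LessSym}\<close> gives a theory contained in \<open>ZFI_less\<close>.\<close>

definition indis_theory :: "sym set \<Rightarrow> fm set" where
  "indis_theory K = ZF K \<union> Coll (insert ISym K) \<union> {Cof} \<union> Indis K"

lemma below_formulas:
  assumes "p \<in> formulas L (length vs)" "\<And>v. v \<in> set vs \<Longrightarrow> v < k"
  shows "below k (app p vs)"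
  using assms by (intro below_app) (auto simp: formulas_iff)

text \<open>Collection for \<open>K\<close> is an instance of collection for
  \<open>insert ISym K\<close>, which leaves a single case for both.\<close>

lemma indis_theory_cases:
  assumes "q \<in> indis_theory K"
  obtains "q \<in> {Extensionality, Foundation, Pairing, Union, Powerset, Infinity, Cof}"
  | n p where "q = separation n p" "p \<in> formulas K (n + 1)"
  | n p where "q = collection n p" "p \<in> formulas (insert ISym K) (n + 2)"
  | n p where "q = indiscernibility n p" "p \<in> formulas K n"
proof -
  have "formulas K k \<subseteq> formulas (insert ISym K) k" for k by (auto simp: formulas_def)
  then show thesis
    using assms that unfolding indis_theory_def ZF_def Sep_def Coll_def Indis_def by blast
qed

lemma indis_theory_closed: assumes "q \<in> indis_theory K" shows "fv q = {}"
proof -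
  have "below 0 q"
    using assms
  proof (cases rule: indis_theory_cases)
    case 1
    then show ?thesis
      by (auto simp: Extensionality_def Foundation_def Pairing_def Union_def Powerset_def
        Infinity_def Cof_def)
  next
    case (2 n p)
    then show ?thesis by (auto simp: separation_def intro!: below_formulas)
  next
    case (3 n p)
    then show ?thesis by (auto simp: collection_def intro!: below_formulas)
  next
    case (4 n p)
    then show ?thesis by (auto simp: indiscernibility_def Let_def intro!: below_formulas)
  qed
  then show ?thesis by (simp add: below_def)
qed

lemma indis_theory_syms: assumes "q \<in> indis_theory K" shows "syms q \<subseteq> insert ISym K"
  using assms
proof (cases rule: indis_theory_cases)
  case 1
  then show ?thesis
    by (auto simp: Extensionality_def Foundation_def Pairing_def Union_def Powerset_def
      Infinity_def Cof_def)
next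
  case (2 n p)
  then show ?thesis by (auto simp: separation_def formulas_def)
next
  case (3 n p)
  then show ?thesis by (auto simp: collection_def formulas_def)
next
  case (4 n p)
  then show ?thesis using syms_IncrI by (fastforce simp: indiscernibility_def Let_def formulas_def)
qed

text \<open>The scheme fixes a number of parameters, an environment does not: any \<open>n\<close>
  above the free variables of \<open>p\<close> serves, and the first \<open>n\<close> entries of
  \<open>z\<close> instantiate the quantified parameters.\<close>

lemma model_separation:
  assumes "\<And>n p. p \<in> formulas L (n + 1) \<Longrightarrow> sat_eq (=) E R I e (separation n p)" and "syms p \<subseteq> L"
  shows "\<exists>w. \<forall>x. E x w \<longleftrightarrow> E x v \<and> sat_eq (=) E R I (x \<cdot> z) p"
proof -
  obtain n where n: "fv p \<subseteq> {..<n}" using finite_nat_iff_bounded[of "fv p"] finite_fv by blast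
  then have p: "below (n + 1) p" by (auto simp: below_def)
  have "sat_eq (=) E R I (\<lambda>m. (x \<cdot> w \<cdot> v \<cdot> join n z e) ((0 # [3..<n + 3]) ! m)) p
      \<longleftrightarrow> sat_eq (=) E R I (x \<cdot> z) p" for x w
    by (rule sat_cong_below[OF p]) (auto simp: nth_Cons add.commute[of 3] split: nat.split)
  moreover have "sat_eq (=) E R I e (separation n p)"
    using assms p by (simp add: formulas_iff)
  then have "sat_eq (=) E R I (v \<cdot> join n z e)
      (Ex (All (0 \<^bold>\<in> 1 \<^bold>\<longleftrightarrow> (0 \<^bold>\<in> 2 \<^bold>\<and> app p (0 # [3..<n + 3])))))"
    unfolding separation_def sat_Alls sat_eq.simps(7) by blast
  ultimately show ?thesis by (simp add: sat_app)
qed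

lemma model_collection:
  assumes "\<And>n p. p \<in> formulas L (n + 2) \<Longrightarrow> sat_eq (=) E R I e (collection n p)" and "syms p \<subseteq> L"
    and "\<And>x. E x v \<Longrightarrow> \<exists>y. sat_eq (=) E R I (x \<cdot> y \<cdot> z) p"
  shows "\<exists>w. \<forall>x. E x v \<longrightarrow> (\<exists>y. E y w \<and> sat_eq (=) E R I (x \<cdot> y \<cdot> z) p)"
proof -
  obtain n where n: "fv p \<subseteq> {..<n}" using finite_nat_iff_bounded[of "fv p"] finite_fv by blast
  then have p: "below (n + 2) p" by (auto simp: below_def)
  have "sat_eq (=) E R I (\<lambda>m. (y \<cdot> x \<cdot> v \<cdot> join n z e) (([1, 0] @ [3..<n + 3]) ! m)) p
      \<longleftrightarrow> sat_eq (=) E R I (x \<cdot> y \<cdot> z) p" for x y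
    by (rule sat_cong_below[OF p]) (auto simp: nth_Cons add.commute[of 3] split: nat.split)
  moreover have "sat_eq (=) E R I (\<lambda>m. (y \<cdot> x \<cdot> w \<cdot> v \<cdot> join n z e) (([1, 0] @ [4..<n + 4]) ! m)) p
      \<longleftrightarrow> sat_eq (=) E R I (x \<cdot> y \<cdot> z) p" for x y w
    by (rule sat_cong_below[OF p]) (auto simp: nth_Cons add.commute[of 4] split: nat.split)
  moreover have "sat_eq (=) E R I e (collection n p)"
    using assms p by (simp add: formulas_iff)
  then have "sat_eq (=) E R I (v \<cdot> join n z e)
      (BAll 0 (Ex (app p ([1, 0] @ [3..<n + 3]))) \<^bold>\<longrightarrow> Ex (BAll 1 (BEx 1 (app p ([1, 0] @ [4..<n + 4])))))"
    unfolding collection_def sat_Alls sat_eq.simps(7) by blast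
  ultimately show ?thesis using assms(3) by (simp add: sat_app)
qed

lemma model_of_indis_theory:
  assumes sat: "\<And>q e. q \<in> indis_theory K \<Longrightarrow> sat_eq (=) E R I e q"
  shows "indiscernible_model E R I K"
proof -
  have ax: "sat_eq (=) E R I e q"
    if "q \<in> {Extensionality, Foundation, Pairing, Union, Powerset, Infinity, Cof}" for q e
    using that by (intro sat) (auto simp: indis_theory_def ZF_def)
  have sep: "sat_eq (=) E R I e (separation n p)" if "p \<in> formulas K (n + 1)" for e n p
    using that by (intro sat) (auto simp: indis_theory_def ZF_def Sep_def)
  have coll: "sat_eq (=) E R I e (collection n p)" if "p \<in> formulas (insert ISym K) (n + 2)" for e n p
    using that by (intro sat) (auto simp: indis_theory_def Coll_def)
  have ind: "sat_eq (=) E R I e (indiscernibility n p)" if "p \<in> formulas K n" for e n p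
    using that by (intro sat) (auto simp: indis_theory_def Indis_def)
  interpret interpretation_of_symbols E R I .
  interpret zf_model E R I K
  proof
    show "x = y" if "\<And>z. E z x \<longleftrightarrow> E z y" for x y
      using ax[of Extensionality] that by (auto simp: Extensionality_def)
    show "\<exists>y. E y x \<and> (\<forall>z. E z x \<longrightarrow> \<not> E z y)" if "E y x" for x y
      using ax[of Foundation] that by (auto simp: Foundation_def Nonempty_def)
    show "\<exists>p. \<forall>z. E z p \<longleftrightarrow> z = a \<or> z = b" for a b
      using ax[of Pairing] by (simp add: Pairing_def IsUPair_def)
    show "\<exists>u. \<forall>z. E z u \<longleftrightarrow> (\<exists>y. E y x \<and> E z y)" for x
      using ax[of Union] by (simp add: Union_def)
    show "\<exists>u. \<forall>z. E z u \<longleftrightarrow> sub z x" for x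
      using ax[of Powerset] by (simp add: Powerset_def)
    show "\<exists>w. (\<exists>z. E z w \<and> (\<forall>u. \<not> E u z)) \<and>
        (\<forall>x. E x w \<longrightarrow> (\<exists>s. E s w \<and> (\<forall>z. E z s \<longleftrightarrow> E z x \<or> z = x)))"
      using ax[of Infinity] by (simp add: Infinity_def Nonempty_def IsSucc_def)
    show "\<exists>w. \<forall>x. E x w \<longleftrightarrow> E x v \<and> sat (x \<cdot> e) p" if "syms p \<subseteq> K" for p v e
      by (rule model_separation[OF sep that])
    show "\<exists>w. \<forall>x. E x v \<longrightarrow> (\<exists>y. E y w \<and> sat (x \<cdot> y \<cdot> e) p)"
      if "syms p \<subseteq> insert ISym K" "\<And>x. E x v \<Longrightarrow> \<exists>y. sat (x \<cdot> y \<cdot> e) p" for p v e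
      by (rule model_collection[OF coll that])
  qed
  show ?thesis
  proof
    show "ord i" if "I i" for i
      using ax[of Cof] that by (simp add: Cof_def)
    show "\<exists>i. I i \<and> (E a i \<or> a = i)" if "ord a" for a
      using ax[of Cof] that by (simp add: Cof_def)
    show "sat x p \<longleftrightarrow> sat y p" if p: "p \<in> formulas K n" and x: "incr n x" and y: "incr n y" for p n x y
    proof -
      have "below n p" using p by (simp add: formulas_iff)
      \<comment> \<open>The first block of quantifiers is outermost and occupies the indices
        \<open>n\<close> to \<open>2 * n - 1\<close>, so \<open>x\<close> belongs to the inner
        \<open>join\<close>.\<close>
      let ?e = "join n y (join n x x)"
      have sx: "sat (\<lambda>m. ?e ([n..<2 * n] ! m)) p \<longleftrightarrow> sat x p"
        by (rule sat_cong_below[OF \<open>below n p\<close>]) simp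
      have sy: "sat (\<lambda>m. ?e ([0..<n] ! m)) p \<longleftrightarrow> sat y p"
        by (rule sat_cong_below[OF \<open>below n p\<close>]) simp
      have ix: "incr n (\<lambda>m. ?e ([n..<2 * n] ! m)) \<longleftrightarrow> incr n x"
        by (rule incr_cong) simp
      have iy: "incr n (\<lambda>m. ?e ([0..<n] ! m)) \<longleftrightarrow> incr n y"
        by (rule incr_cong) simp
      have "sat ?e (IncrI [n..<2 * n] \<^bold>\<and> IncrI [0..<n] \<^bold>\<longrightarrow> (app p [n..<2 * n] \<^bold>\<longleftrightarrow> app p [0..<n]))"
        using ind[OF p, of x] unfolding indiscernibility_def Let_def sat_Alls by blast
      then show ?thesis using x y by (simp add: sat_app sx sy ix iy)
    qed
  qed
qed

section \<open>The sentences of the theorem in a model\<close>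

context indiscernible_model
begin

lemma sat_apartness: assumes p: "p \<in> formulas K (n + 1)" shows "sat e (apartness n p)"
proof -
  have "below (n + 1) p" using p by (simp add: formulas_iff)
  have app: "sat (y \<cdot> join n x e) (app p ([1..<n + 1] @ [0])) \<longleftrightarrow> sat (join n x (\<lambda>_. y)) p" for y x e
    unfolding sat_app
  proof (rule sat_cong_below[OF \<open>below (n + 1) p\<close>])
    fix v assume "v < n + 1"
    moreover have "[1..<n + 1] ! v = Suc v" if "v < n" using that by (subst nth_upt) auto
    ultimately show "(y \<cdot> join n x e) (([1..<n + 1] @ [0]) ! v) = join n x (\<lambda>_. y) v"
      by (cases "v = n") (simp_all add: nth_append del: upt_Suc)
  qed
  show ?thesis
    unfolding apartness_def sat_eq.simps sat_Alls sat_And sat_Ex sat_Conj app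
    using apartness_model[OF p] by auto
qed

lemma sat_diagonal_indis:
  assumes p: "p \<in> formulas K (n + 1 + r)" and r: "r \<ge> 1" shows "sat e (diagonal_indis n r p)"
proof -
  have "below (n + 1 + r) p" using p by (simp add: formulas_iff)
  let ?e = "\<lambda>i j k. join r k (join r j (i \<cdot> e))"
  \<comment> \<open>Since \<open>r \<ge> 1\<close>, the indices \<open>r\<close> and
    \<open>0\<close> fall inside the two blocks and name their first entries.\<close>
  have env: "?e i j k (2 * r) = i" "?e i j k r = j 0" "?e i j k 0 = k 0"
    "m < r \<Longrightarrow> ?e i j k (r + m) = j m" for i j k m
    using join_ge(1)[of r k "join r j (i \<cdot> e)" r] r by (simp_all add: mult_2)
  have args: "v < n \<or> v = n \<or> (\<exists>m < r. v = Suc (n + m))" if "v < n + 1 + r" for v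
    using that less_iff_Suc_add[of n v] by auto
  have j: "sat (join n x (?e i j k)) (app p ([0..<n] @ [2 * r + n] @ [r + n..<2 * r + n]))
      \<longleftrightarrow> sat (join n x (i \<cdot> j)) p" for x i j k
    unfolding sat_app
  proof (rule sat_cong_below[OF \<open>below (n + 1 + r) p\<close>])
    fix v assume "v < n + 1 + r"
    moreover have "join n x (?e i j k) (r + n + m) = j m" if "m < r" for m
    proof -
      have eq: "r + n + m = n + (r + m)" by simp
      show ?thesis unfolding eq join_ge(1) using that by simp
    qed
    ultimately show "join n x (?e i j k) (([0..<n] @ [2 * r + n] @ [r + n..<2 * r + n]) ! v) = join n x (i \<cdot> j) v"
      using args[of v] by (auto simp: nth_append env)
  qed
  have k: "sat (join n x (?e i j k)) (app p ([0..<n] @ [2 * r + n] @ [n..<r + n]))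
      \<longleftrightarrow> sat (join n x (i \<cdot> k)) p" for x i j k
    unfolding sat_app
  proof (rule sat_cong_below[OF \<open>below (n + 1 + r) p\<close>])
    fix v assume "v < n + 1 + r"
    then show "join n x (?e i j k) (([0..<n] @ [2 * r + n] @ [n..<r + n]) ! v) = join n x (i \<cdot> k) v"
      using args[of v] by (auto simp: nth_append env)
  qed
  have incr_j: "incr (length [r..<2 * r]) (\<lambda>m. ?e i j k ([r..<2 * r] ! m)) \<longleftrightarrow> incr r j" for i j k
  proof -
    have "length [r..<2 * r] = r" by simp
    then show ?thesis by (simp only:) (rule incr_cong, simp)
  qed
  have incr_k: "incr (length [0..<r]) (\<lambda>m. ?e i j k ([0..<r] ! m)) \<longleftrightarrow> incr r k" for i j k
    unfolding length_upt diff_zero by (rule incr_cong) simp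
  show ?thesis
    unfolding diagonal_indis_def sat_eq.simps sat_Alls sat_And sat_IncrI incr_j incr_k env
      sat_Conj sat_Iff j k
    using diagonal_model[OF p r] by (simp add: env)
qed

end

section \<open>From models back to derivability\<close>

lemma indis_theory_derives:
  assumes "syms p \<subseteq> insert ISym K"
    and "\<And>(E :: nat \<Rightarrow> nat \<Rightarrow> bool) R I e. indiscernible_model E R I K \<Longrightarrow> sat_eq (=) E R I e p"
  shows "derives (insert ISym K) (indis_theory K) p"
proof (rule completeness)
  show "Pairing \<in> indis_theory K" "Infinity \<in> indis_theory K" by (simp_all add: indis_theory_def ZF_def)
  show "sat_eq (=) E R I e p" if "\<And>q e. q \<in> indis_theory K \<Longrightarrow> sat_eq (=) E R I e q"
    for E :: "nat \<Rightarrow> nat \<Rightarrow> bool" and R I e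
    using that by (intro assms(2) model_of_indis_theory)
qed (fact indis_theory_closed indis_theory_syms assms(1))+

lemma derives_apartness:
  assumes "p \<in> formulas K (n + 1)"
  shows "derives (insert ISym K) (indis_theory K) (apartness n p)"
proof (rule indis_theory_derives)
  show "syms (apartness n p) \<subseteq> insert ISym K"
    using assms by (auto simp: apartness_def formulas_iff)
qed (rule indiscernible_model.sat_apartness[OF _ assms])

lemma derives_diagonal_indis:
  assumes "p \<in> formulas K (n + 1 + r)" "r \<ge> 1"
  shows "derives (insert ISym K) (indis_theory K) (diagonal_indis n r p)"
proof (rule indis_theory_derives)
  show "syms (diagonal_indis n r p) \<subseteq> insert ISym K"
    using assms(1) syms_IncrI by (fastforce simp: diagonal_indis_def formulas_iff)
qed (rule indiscernible_model.sat_diagonal_indis[OF _ assms])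

theorem theorem3p2:
  "(\<forall>n p. p \<in> formulas {} (n + 1) \<longrightarrow> derives {ISym} ZFI (apartness n p))
    \<and> (\<forall>n r p. r \<ge> 1 \<longrightarrow> p \<in> formulas {} (n + 1 + r) \<longrightarrow> derives {ISym} ZFI (diagonal_indis n r p))
    \<and> (\<forall>n p. p \<in> formulas {LessSym} (n + 1) \<longrightarrow>
          derives {LessSym, ISym} ZFI_less (apartness n p))
    \<and> (\<forall>n r p. r \<ge> 1 \<longrightarrow> p \<in> formulas {LessSym} (n + 1 + r) \<longrightarrow>
          derives {LessSym, ISym} ZFI_less (diagonal_indis n r p))"
proof -
  have ZFI: "ZFI = indis_theory {}" by (simp add: ZFI_def indis_theory_def)
  have L: "{LessSym, ISym} = insert ISym {LessSym}" by blast
  have less: "indis_theory {LessSym} \<subseteq> ZFI_less"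
    by (auto simp: ZFI_less_def indis_theory_def L)
  show ?thesis
    unfolding ZFI L using derives_apartness derives_diagonal_indis derives_weaken[OF _ less] by blast
qed

end
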